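(* Let $X,X_1,X_2,\dots$ be any independent identically distributed real-valued random variables, let $f(t)=\mathsf{E}e^{itX}$ be the characteristic function of $X$, and for $n=0,1,\dots$ let $S_n:=\sum_{j=1}^n X_j$ (so $S_0=0$), $M_n:=\max_{0\le k\le n}S_k$, and $$\varphi_n(s,t):=\mathsf{E}\exp\{i[sM_n+t(M_n-S_n)]\}.$$ Then for all real $s,t$ and all complex $z$ with $|z|<1$, $$\sum_{n=0}^\infty\varphi_n(s,t)z^n=\frac1{\sqrt{(1-zf(s))(1-zf(-t))}}\,\exp\Big\{\frac1{4\pi i}\int_{-\infty}^\infty\frac{du}u\,\Big(\ln\frac{1-zf(s-u)}{1-zf(s+u)}+\ln\frac{1-zf(-t+u)}{1-zf(-t-u)}\Big)\Big\}.$$ In the special case $t=0$, this yields $$\sum_{n=0}^\infty\mathsf{E}\,e^{isM_n}z^n=\frac1{\sqrt{(1-zf(s))(1-z)}}\,\exp\Big\{\frac1{4\pi i}\int_{-\infty}^\infty\frac{du}u\,\Big(\ln\frac{1-zf(s-u)}{1-zf(s+u)}+\ln\frac{1-zf(u)}{1-zf(-u)}\Big)\Big\}.$$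
   Context: The integrals $\int_{-\infty}^\infty$ are understood in the principal-value sense, $\int_{-\infty}^\infty:=\lim_{\varepsilon\downarrow0,\,A\uparrow\infty}\left(\int_\varepsilon^A+\int_{-A}^{-\varepsilon}\right)$, and existence of these limits is part of the assertion. The logarithm $\ln$ and the square root are the principal branches (with argument in $(-\pi,\pi)$); since $|z|<1$ and $|f|\le1$, each factor $1-zf(\cdot)$ has argument in $(-\frac\pi2,\frac\pi2)$, so all quotients and products to which $\ln$ or $\sqrt{\cdot}$ is applied have argument in $(-\pi,\pi)$. *)

theory Defs
  imports "HOL-Probability.Probability"
begin

definition walk :: "(nat \<Rightarrow> 'a \<Rightarrow> real) \<Rightarrow> nat \<Rightarrow> 'a \<Rightarrow> real" where
  "walk X n \<omega> = (\<Sum>j=1..n. X j \<omega>)"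

definition walk_max :: "(nat \<Rightarrow> 'a \<Rightarrow> real) \<Rightarrow> nat \<Rightarrow> 'a \<Rightarrow> real" where
  "walk_max X n \<omega> = Max ((\<lambda>k. walk X k \<omega>) ` {0..n})"

definition joint_cf ::
    "'a measure \<Rightarrow> (nat \<Rightarrow> 'a \<Rightarrow> real) \<Rightarrow> nat \<Rightarrow> real \<Rightarrow> real \<Rightarrow> complex" where
  "joint_cf M X n s t =
     (LINT \<omega>|M. exp (\<i> * of_real (s * walk_max X n \<omega> + t * (walk_max X n \<omega> - walk X n \<omega>))))"

(* Principal value at 0 and at infinity over the real line. The two cut-offs tend to their limits
   jointly and independently (product filter). Integrability on every truncated domain is demanded
   explicitly because the Bochner integral of a non-integrable function is 0 by convention. *)
definition has_pv_integral :: "(real \<Rightarrow> complex) \<Rightarrow> complex \<Rightarrow> bool" where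
  "has_pv_integral g I \<longleftrightarrow>
     (\<forall>\<epsilon> A. 0 < \<epsilon> \<and> \<epsilon> < A \<longrightarrow>
        set_integrable lborel {\<epsilon>..A} g \<and> set_integrable lborel {-A..-\<epsilon>} g) \<and>
     ((\<lambda>(\<epsilon>, A). (LINT u:{\<epsilon>..A}|lborel. g u) + (LINT u:{-A..-\<epsilon>}|lborel. g u)) \<longlongrightarrow> I)
       (at_right 0 \<times>\<^sub>F at_top)"

end

theory Submission
  imports Defs
begin

text \<open>
  Two facts combine. The first is Spitzer's identity: with
  \<open>p\<^sub>k(u) = E[exp(iuS\<^sub>k); S\<^sub>k > 0]\<close> and \<open>q\<^sub>k(u) = E[exp(iuS\<^sub>k); S\<^sub>k \<le> 0]\<close>,
  the generating function of the joint characteristic functions is the exponential of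
  \<open>\<Sum>\<^sub>k (p\<^sub>k(s) + q\<^sub>k(-t)) z\<^sup>k / k\<close> (lemma \<open>spitzer_identity\<close>). The second is that the
  principal value integral extracts these half-line parts from the powers \<open>f\<^sup>k\<close>: since
  \<open>\<integral> sin(ux)/u du\<close> over the positive half-line is \<open>\<pi>/2 sgn x\<close>, the integral of
  \<open>(f\<^sup>k(s+u) - f\<^sup>k(s-u))/u\<close> over that half-line equals \<open>\<pi>i E[exp(isS\<^sub>k) sgn S\<^sub>k]\<close>
  (lemma \<open>tendsto_trunc_hilbert_char\<close>), which is \<open>\<pi>i\<close> times \<open>p\<^sub>k(s) - q\<^sub>k(s) + P(S\<^sub>k = 0)\<close>. Summation
  against \<open>z\<^sup>k/k\<close> turns \<open>f\<^sup>k\<close> into \<open>-ln(1 - z f)\<close>; the truncated integrals are bounded uniformly in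
  \<open>k\<close> and in both cut-offs, so Tannery's theorem permits the passage to the limit. The atoms at \<open>0\<close>
  cancel between \<open>s\<close> and \<open>-t\<close>, and the square root supplies the sums
  \<open>p\<^sub>k + q\<^sub>k = f\<^sup>k\<close> that complete the differences \<open>p\<^sub>k - q\<^sub>k\<close>.

  Spitzer's identity itself is a Wiener-Hopf factorization. Cutting the walk at the first time at
  which it attains its maximum factors the generating function as \<open>A(s) B(-t)\<close>, where the
  coefficients of \<open>A\<close> are Fourier transforms of measures on the positive half-line and those of \<open>B\<close> of
  measures on the nonpositive one (lemma \<open>joint_cf_decomposition\<close>). For \<open>t = -s\<close> the product is
  \<open>1/(1 - z f(s))\<close>. The exponentials of \<open>\<Sum>\<^sub>k p\<^sub>k z\<^sup>k/k\<close> and \<open>\<Sum>\<^sub>k q\<^sub>k z\<^sup>k/k\<close> have the same support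
  properties and the same product, so it remains to see that such a factorization is unique
  (lemma \<open>factorization_unique\<close>). Coefficient by coefficient this says that a function
  which is the transform of something on the positive half-line and also of something on the
  nonpositive half-line vanishes, and the same truncated integrals prove it: they act on the two
  classes with opposite signs.
\<close>

section \<open>Truncated Hilbert transforms of characteristic functions\<close>

text \<open>
  The sign of \<open>x\<close> enters the whole argument here: as \<open>\<epsilon> \<rightarrow> 0\<close> and \<open>A \<rightarrow> \<infinity>\<close> the right-hand side
  tends to \<open>\<pi>/2 sgn x\<close>, and it stays bounded because \<open>Si\<close> is bounded.
\<close>

lemma integral_sin_over_u:
  fixes \<epsilon> A x :: real
  assumes "0 < \<epsilon>" "\<epsilon> \<le> A"
  shows "(LINT u:{\<epsilon>..A}|lborel. sin (u * x) / u) = sgn x * (Si (A * \<bar>x\<bar>) - Si (\<epsilon> * \<bar>x\<bar>))"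
proof -
  let ?F = "\<lambda>u. sgn x * Si (u * \<bar>x\<bar>)"
  have "(LINT u|lborel. indicator {\<epsilon>..A} u *\<^sub>R (sin (u * x) / u)) = ?F A - ?F \<epsilon>"
  proof (rule integral_FTC_Icc)
    fix u assume u: "\<epsilon> \<le> u" "u \<le> A"
    then have "u > 0" using assms by simp
    have "((\<lambda>u. Si (u * \<bar>x\<bar>)) has_real_derivative sinc (u * \<bar>x\<bar>) * \<bar>x\<bar>) (at u)"
      by (rule DERIV_chain'[OF _ DERIV_Si]) (auto intro!: derivative_eq_intros)
    then have "(?F has_real_derivative sgn x * (sinc (u * \<bar>x\<bar>) * \<bar>x\<bar>)) (at u)"
      by (rule DERIV_cmult)
    also have "sgn x * (sinc (u * \<bar>x\<bar>) * \<bar>x\<bar>) = sin (u * x) / u"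
      using \<open>u > 0\<close> by (auto simp: sgn_if field_simps abs_if)
    finally show "(?F has_vector_derivative sin (u * x) / u) (at u within {\<epsilon>..A})"
      by (simp add: has_real_derivative_iff_has_vector_derivative has_vector_derivative_at_within)
  next
    show "continuous_on {\<epsilon>..A} (\<lambda>u. sin (u * x) / u)"
      using assms by (intro continuous_intros) auto
  qed fact
  then show ?thesis by (simp add: set_lebesgue_integral_def right_diff_distrib)
qed

text \<open>
  Folding the two truncated half-lines onto the positive one: for \<open>k(u) = h(u)/u\<close> this is
  the integral of \<open>k\<close> over \<open>\<epsilon> \<le> \<bar>u\<bar> \<le> A\<close>, so the double limit is, up to a factor, the Hilbert transform of
  \<open>h\<close> at \<open>0\<close>. Applied to a translate \<open>u \<mapsto> a(s + u)\<close> it gives the transform of \<open>a\<close> at \<open>s\<close>.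
\<close>

definition trunc_hilbert :: "(real \<Rightarrow> complex) \<Rightarrow> real \<Rightarrow> real \<Rightarrow> complex" where
  "trunc_hilbert h \<epsilon> A = (LINT u:{\<epsilon>..A}|lborel. (h u - h (-u)) / of_real u)"

abbreviation pv_filter :: "(real \<times> real) filter" where
  "pv_filter \<equiv> at_right 0 \<times>\<^sub>F at_top"

lemma pv_filter_nonbot: "pv_filter \<noteq> bot"
  by (simp add: prod_filter_eq_bot)

lemma eventually_pv_filter: "eventually (\<lambda>(\<epsilon>, A). 0 < \<epsilon> \<and> \<epsilon> < A) pv_filter"
proof -
  have 1: "eventually (\<lambda>\<epsilon>. 0 < \<epsilon> \<and> \<epsilon> < 1) (at_right (0::real))"
    using eventually_at_right_real[OF zero_less_one] by eventually_elim auto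
  have 2: "eventually (\<lambda>A::real. 1 < A) at_top" by (rule eventually_gt_at_top)
  show ?thesis
    by (rule eventually_mono[OF eventually_prodI[OF 1 2]]) auto
qed

lemma iexp_diff_sin: "iexp ((s + u) * x) - iexp ((s - u) * x) = 2 * \<i> * (iexp (s * x) * of_real (sin (u * x)))"
proof -
  have "iexp ((s + u) * x) = iexp (s * x) * iexp (u * x)"
    "iexp ((s - u) * x) = iexp (s * x) * iexp (- (u * x))"
    by (simp_all add: distrib_right left_diff_distrib distrib_left right_diff_distrib exp_add exp_diff exp_minus field_simps)
  moreover have "iexp (u * x) - iexp (- (u * x)) = 2 * \<i> * of_real (sin (u * x))"
    unfolding cis_conv_exp[symmetric] by (simp add: complex_eq_iff)
  ultimately show ?thesis by (simp add: right_diff_distrib[symmetric] mult_ac)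
qed

context finite_borel_measure
begin

lemma space_UNIV: "space M = UNIV"
  using M_is_borel sets_eq_imp_space_eq by fastforce

lemma borel_measurable_of_borel: "g \<in> borel_measurable borel \<Longrightarrow> g \<in> borel_measurable M"
  using M_is_borel measurable_cong_sets by blast

lemma integrable_bounded_borel:
  fixes g :: "real \<Rightarrow> complex"
  assumes "g \<in> borel_measurable borel" "\<And>x. norm (g x) \<le> B"
  shows "integrable M g"
  by (rule integrable_const_bound[of _ B]) (use assms borel_measurable_of_borel in auto)

lemma char_diff_over_u:
  "(char M (s + u) - char M (s - u)) / of_real u =
     2 * \<i> * (CLINT x|M. iexp (s * x) * of_real (sin (u * x) / u))"
proof -
  have "char M (s + u) - char M (s - u) = (CLINT x|M. iexp ((s + u) * x) - iexp ((s - u) * x))"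
    unfolding char_def
    by (subst Bochner_Integration.integral_diff) (auto intro!: integrable_bounded_borel[where B=1])
  also have "\<dots> / of_real u = (CLINT x|M. (iexp ((s + u) * x) - iexp ((s - u) * x)) / of_real u)"
    by simp
  also have "\<dots> = (CLINT x|M. 2 * \<i> * (iexp (s * x) * of_real (sin (u * x) / u)))"
    unfolding iexp_diff_sin by (intro Bochner_Integration.integral_cong) auto
  finally show ?thesis by simp
qed

text \<open>
  Fubini moves the \<open>u\<close>-integral inside, where only the odd part \<open>2i sin(ux)\<close> of
  \<open>exp(iux)\<close> survives. The integrand is bounded by \<open>1/\<epsilon>\<close> on a set of finite measure, so absolute
  integrability is free on the truncated domain.
\<close>

lemma trunc_hilbert_char:
  assumes "0 < \<epsilon>" "\<epsilon> \<le> A"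
  shows "trunc_hilbert (\<lambda>u. char M (s + u)) \<epsilon> A =
    2 * \<i> * (CLINT x|M. iexp (s * x) * of_real (sgn x * (Si (A * \<bar>x\<bar>) - Si (\<epsilon> * \<bar>x\<bar>))))"
proof -
  interpret L: pair_sigma_finite M lborel ..
  let ?f = "\<lambda>x u. iexp (s * x) * of_real (sin (u * x) / u)"
  let ?g = "\<lambda>x u. indicator {\<epsilon>..A} u *\<^sub>R ?f x u"
  have [measurable_cong]: "sets M = sets borel" by (rule M_is_borel)
  have "integrable (M \<Otimes>\<^sub>M lborel) (\<lambda>p. indicator (UNIV \<times> {\<epsilon>..A}) p *\<^sub>R case_prod ?f p)"
  proof (rule integrableI_bounded_set_indicator)
    show S: "UNIV \<times> {\<epsilon>..A} \<in> sets (M \<Otimes>\<^sub>M lborel)"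
      by (auto simp: M_is_borel)
    have "emeasure (M \<Otimes>\<^sub>M lborel) (UNIV \<times> {\<epsilon>..A}) = emeasure M UNIV * emeasure lborel {\<epsilon>..A}"
      by (rule lborel.emeasure_pair_measure_Times) (auto simp: M_is_borel)
    also have "\<dots> < \<infinity>"
    proof -
      have "emeasure M UNIV < top" by (simp add: less_top[symmetric])
      then show ?thesis using assms by (simp add: ennreal_mult_less_top)
    qed
    finally show "emeasure (M \<Otimes>\<^sub>M lborel) (UNIV \<times> {\<epsilon>..A}) < \<infinity>" .
    show "case_prod ?f \<in> borel_measurable (M \<Otimes>\<^sub>M lborel)"
      by measurable
    show "AE p in M \<Otimes>\<^sub>M lborel. p \<in> UNIV \<times> {\<epsilon>..A} \<longrightarrow> norm (case_prod ?f p) \<le> 1 / \<epsilon>"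
    proof (rule AE_I2, safe)
      fix x u :: real assume "u \<in> {\<epsilon>..A}"
      then have "\<bar>sin (u * x)\<bar> / \<bar>u\<bar> \<le> 1 / \<epsilon>"
        using assms by (intro frac_le) auto
      then show "norm (?f x u) \<le> 1 / \<epsilon>"
        by (simp add: norm_mult norm_divide)
    qed
  qed
  then have int: "integrable (M \<Otimes>\<^sub>M lborel) (case_prod ?g)"
    by (rule back_subst[of "integrable _"]) (auto simp: indicator_def)
  have "trunc_hilbert (\<lambda>u. char M (s + u)) \<epsilon> A =
      (LINT u|lborel. indicator {\<epsilon>..A} u *\<^sub>R (2 * \<i> * (CLINT x|M. ?f x u)))"
    unfolding trunc_hilbert_def set_lebesgue_integral_def
    by (simp only: char_diff_over_u[of s, symmetric] diff_conv_add_uminus)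
  also have "\<dots> = 2 * \<i> * (LINT u|lborel. (CLINT x|M. ?g x u))"
    unfolding integral_scaleR_right
    by (simp only: mult_scaleR_right[symmetric] integral_mult_right_zero)
  also have "(LINT u|lborel. (CLINT x|M. ?g x u)) = (CLINT x|M. (LINT u|lborel. ?g x u))"
    using L.Fubini_integral[OF int] by simp
  also have "\<dots> = (CLINT x|M. iexp (s * x) * of_real (LINT u:{\<epsilon>..A}|lborel. sin (u * x) / u))"
    unfolding set_lebesgue_integral_def
    by (intro Bochner_Integration.integral_cong refl)
       (simp flip: integral_complex_of_real integral_mult_right_zero add: scaleR_conv_of_real mult_ac)
  also have "\<dots> = (CLINT x|M. iexp (s * x) * of_real (sgn x * (Si (A * \<bar>x\<bar>) - Si (\<epsilon> * \<bar>x\<bar>))))"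
    using integral_sin_over_u[OF assms] by simp
  finally show ?thesis .
qed

text \<open>
  A bound that is uniform in both cut-offs and depends on the measure only through its mass; it
  provides the dominating series when the transforms of the powers of a characteristic function
  are summed.
\<close>

lemma norm_trunc_hilbert_char_le:
  assumes "\<And>T. \<bar>Si T\<bar> \<le> B" "0 < \<epsilon>" "\<epsilon> \<le> A"
  shows "norm (trunc_hilbert (\<lambda>u. char M (s + u)) \<epsilon> A) \<le> 4 * B * measure M UNIV"
proof -
  let ?k = "\<lambda>x. iexp (s * x) * of_real (sgn x * (Si (A * \<bar>x\<bar>) - Si (\<epsilon> * \<bar>x\<bar>)))"
  have B: "0 \<le> B" using assms(1)[of 0] by linarith
  have bound: "norm (?k x) \<le> 2 * B" for x
  proof -
    have "\<bar>Si (A * \<bar>x\<bar>) - Si (\<epsilon> * \<bar>x\<bar>)\<bar> \<le> 2 * B"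
      using assms(1)[of "A * \<bar>x\<bar>"] assms(1)[of "\<epsilon> * \<bar>x\<bar>"] by linarith
    then show ?thesis using B by (auto simp: norm_mult sgn_if simp flip: of_real_diff)
  qed
  have "norm (CLINT x|M. ?k x) \<le> (LINT x|M. norm (?k x))"
    by (rule integral_norm_bound)
  also have "\<dots> \<le> (LINT x|M. 2 * B)"
  proof (rule integral_mono)
    show "integrable M (\<lambda>x. norm (?k x))"
      by (intro integrable_norm integrable_bounded_borel[OF _ bound]) measurable
  qed (use bound in auto)
  also have "\<dots> = 2 * B * measure M UNIV" by (simp add: space_UNIV)
  finally show ?thesis
    unfolding trunc_hilbert_char[OF assms(2,3)] by (simp add: norm_mult)
qed

lemma tendsto_Si_transform_at_top:
  "((\<lambda>A. CLINT x|M. iexp (s * x) * of_real (sgn x * Si (A * \<bar>x\<bar>))) \<longlongrightarrow>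
     pi / 2 * (CLINT x|M. iexp (s * x) * of_real (sgn x))) at_top"
proof -
  obtain B where B: "\<And>T. \<bar>Si T\<bar> \<le> B" using bounded_Si by blast
  have "((\<lambda>A. CLINT x|M. iexp (s * x) * of_real (sgn x * Si (A * \<bar>x\<bar>))) \<longlongrightarrow>
     (CLINT x|M. iexp (s * x) * of_real (sgn x * (pi / 2)))) at_top"
  proof (rule integral_dominated_convergence_at_top[where w="\<lambda>_. B"])
    show "AE x in M. ((\<lambda>A. iexp (s * x) * of_real (sgn x * Si (A * \<bar>x\<bar>))) \<longlongrightarrow>
       iexp (s * x) * of_real (sgn x * (pi / 2))) at_top"
    proof (rule AE_I2)
      fix x :: real
      show "((\<lambda>A. iexp (s * x) * of_real (sgn x * Si (A * \<bar>x\<bar>))) \<longlongrightarrow>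
         iexp (s * x) * of_real (sgn x * (pi / 2))) at_top"
      proof (cases "x = 0")
        case False
        then have "filterlim (\<lambda>A. A * \<bar>x\<bar>) at_top at_top"
          by (auto intro!: filterlim_at_top_mult_tendsto_pos[OF tendsto_const] simp: filterlim_ident)
        from filterlim_compose[OF Si_at_top this] show ?thesis
          by (intro tendsto_intros) 
      qed simp
    qed
    show "\<forall>\<^sub>F A in at_top. AE x in M. norm (iexp (s * x) * of_real (sgn x * Si (A * \<bar>x\<bar>))) \<le> B"
    proof (intro always_eventually allI AE_I2)
      fix A x :: real
      show "norm (iexp (s * x) * of_real (sgn x * Si (A * \<bar>x\<bar>))) \<le> B"
        using B[of "A * \<bar>x\<bar>"] B[of 0] by (auto simp: norm_mult sgn_if)
    qed
  qed (auto intro!: borel_measurable_of_borel)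
  also have "(CLINT x|M. iexp (s * x) * of_real (sgn x * (pi / 2))) =
      pi / 2 * (CLINT x|M. iexp (s * x) * of_real (sgn x))"
    by (simp flip: integral_mult_right_zero add: mult_ac)
  finally show ?thesis .
qed

text \<open>
  Substituting \<open>\<epsilon> = 1/A\<close> reduces this to dominated convergence along \<open>A \<rightarrow> \<infinity>\<close>.
\<close>

lemma tendsto_Si_transform_at_right_0:
  "((\<lambda>\<epsilon>. CLINT x|M. iexp (s * x) * of_real (sgn x * Si (\<epsilon> * \<bar>x\<bar>))) \<longlongrightarrow> 0) (at_right 0)"
proof -
  obtain B where B: "\<And>T. \<bar>Si T\<bar> \<le> B" using bounded_Si by blast
  have "((\<lambda>A. CLINT x|M. iexp (s * x) * of_real (sgn x * Si (inverse A * \<bar>x\<bar>))) \<longlongrightarrow>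
     (CLINT x|M. 0)) at_top"
  proof (rule integral_dominated_convergence_at_top[where w="\<lambda>_. B"])
    show "AE x in M. ((\<lambda>A. iexp (s * x) * of_real (sgn x * Si (inverse A * \<bar>x\<bar>))) \<longlongrightarrow> 0) at_top"
    proof (rule AE_I2)
      fix x :: real
      have "((\<lambda>A. inverse A * \<bar>x\<bar>) \<longlongrightarrow> 0) at_top"
        by (rule tendsto_mult_left_zero[OF tendsto_inverse_0_at_top[OF filterlim_ident]])
      then have "((\<lambda>A. Si (inverse A * \<bar>x\<bar>)) \<longlongrightarrow> Si 0) at_top"
        by (rule isCont_tendsto_compose[OF isCont_Si])
      then have "((\<lambda>A. iexp (s * x) * of_real (sgn x * Si (inverse A * \<bar>x\<bar>))) \<longlongrightarrow>
         iexp (s * x) * of_real (sgn x * Si 0)) at_top"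
        by (intro tendsto_intros)
      moreover have "Si 0 = 0" using Si_neg[of 0] by simp
      ultimately show "((\<lambda>A. iexp (s * x) * of_real (sgn x * Si (inverse A * \<bar>x\<bar>))) \<longlongrightarrow> 0) at_top"
        by simp
    qed
    show "\<forall>\<^sub>F A in at_top. AE x in M. norm (iexp (s * x) * of_real (sgn x * Si (inverse A * \<bar>x\<bar>))) \<le> B"
    proof (intro always_eventually allI AE_I2)
      fix A x :: real
      show "norm (iexp (s * x) * of_real (sgn x * Si (inverse A * \<bar>x\<bar>))) \<le> B"
        using B[of "inverse A * \<bar>x\<bar>"] B[of 0] by (auto simp: norm_mult sgn_if)
    qed
  qed (auto intro!: borel_measurable_of_borel)
  from filterlim_compose[OF this filterlim_inverse_at_top_right] show ?thesis by simp
qed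

text \<open>
  The truncated transform is a difference of a function of \<open>A\<close> and a function of \<open>\<epsilon>\<close>, so the
  joint limit exists as soon as the two separate ones do.
\<close>

lemma tendsto_trunc_hilbert_char:
  "((\<lambda>(\<epsilon>, A). trunc_hilbert (\<lambda>u. char M (s + u)) \<epsilon> A) \<longlongrightarrow>
     \<i> * pi * (CLINT x|M. iexp (s * x) * of_real (sgn x))) pv_filter"
proof -
  let ?k = "\<lambda>A x. iexp (s * x) * complex_of_real (sgn x * Si (A * \<bar>x\<bar>))"
  let ?K = "\<lambda>A. CLINT x|M. ?k A x"
  obtain B where B: "\<And>T. \<bar>Si T\<bar> \<le> B" using bounded_Si by blast
  have int: "integrable M (?k A)" for A
  proof (rule integrable_bounded_borel[where B=B])
    show "norm (?k A x) \<le> B" for x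
      using B[of "A * \<bar>x\<bar>"] B[of 0] by (auto simp: norm_mult sgn_if)
  qed measurable
  have "((\<lambda>p. 2 * \<i> * (?K (snd p) - ?K (fst p))) \<longlongrightarrow>
      2 * \<i> * (pi / 2 * (CLINT x|M. iexp (s * x) * of_real (sgn x)) - 0)) pv_filter"
    by (intro tendsto_intros filterlim_compose[OF tendsto_Si_transform_at_top filterlim_snd]
        filterlim_compose[OF tendsto_Si_transform_at_right_0 filterlim_fst])
  moreover have "eventually (\<lambda>p. 2 * \<i> * (?K (snd p) - ?K (fst p)) =
      (\<lambda>(\<epsilon>, A). trunc_hilbert (\<lambda>u. char M (s + u)) \<epsilon> A) p) pv_filter"
    using eventually_pv_filter
  proof eventually_elim
    case (elim p)
    then obtain \<epsilon> A where p: "p = (\<epsilon>, A)" "0 < \<epsilon>" "\<epsilon> < A" by (cases p) auto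
    have "?K A - ?K \<epsilon> = (CLINT x|M. ?k A x - ?k \<epsilon> x)"
      using int by (simp add: Bochner_Integration.integral_diff)
    then show ?case using p
      by (simp add: trunc_hilbert_char right_diff_distrib)
  qed
  ultimately have "((\<lambda>(\<epsilon>, A). trunc_hilbert (\<lambda>u. char M (s + u)) \<epsilon> A) \<longlongrightarrow>
      2 * \<i> * (pi / 2 * (CLINT x|M. iexp (s * x) * of_real (sgn x)) - 0)) pv_filter"
    by (rule Lim_transform_eventually)
  then show ?thesis by (simp add: mult.assoc)
qed

end

section \<open>Fourier transforms of measures on a half-line\<close>

lemma (in finite_borel_measure) isCont_char_finite: "isCont (char M) t"
  unfolding continuous_at_sequentially
proof safe
  fix X assume X: "X \<longlonglongrightarrow> t"
  show "(char M \<circ> X) \<longlonglongrightarrow> char M t"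
    unfolding comp_def char_def
    by (rule integral_dominated_convergence[where w="\<lambda>_. 1"])
       (auto intro!: tendsto_intros X borel_measurable_of_borel)
qed

text \<open>
  The complex span of the Fourier transforms of finite measures carried by \<open>S\<close>, that is, the
  transforms of the complex measures carried by \<open>S\<close>. The span avoids complex measures altogether:
  every property needed is linear and can be checked on the generators, and products of
  generators are handled by convolution of finite measures.
\<close>

inductive fourier_span :: "real set \<Rightarrow> (real \<Rightarrow> complex) \<Rightarrow> bool" for S where
  char: "finite_borel_measure D \<Longrightarrow> (AE x in D. x \<in> S) \<Longrightarrow> fourier_span S (char D)"
| add: "fourier_span S a \<Longrightarrow> fourier_span S b \<Longrightarrow> fourier_span S (\<lambda>u. a u + b u)"
| cmult: "fourier_span S a \<Longrightarrow> fourier_span S (\<lambda>u. c * a u)"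

lemma fourier_span_zero: "fourier_span S (\<lambda>_. 0)"
proof -
  have "finite_borel_measure (null_measure borel)"
    by (auto intro!: finite_borel_measure.intro finite_measureI simp: finite_borel_measure_axioms_def)
  moreover have "AE x in null_measure borel. x \<in> S"
    by (rule AE_I[where N=UNIV]) auto
  ultimately have "fourier_span S (\<lambda>u. 0 * char (null_measure borel) u)"
    by (intro fourier_span.cmult fourier_span.char)
  then show ?thesis by simp
qed

lemma fourier_span_diff:
  "fourier_span S a \<Longrightarrow> fourier_span S b \<Longrightarrow> fourier_span S (\<lambda>u. a u - b u)"
  using fourier_span.add[of S a "\<lambda>u. (-1) * b u"] fourier_span.cmult[of S b "-1"] by simp

lemma fourier_span_sum:
  "(\<And>i. i \<in> I \<Longrightarrow> fourier_span S (a i)) \<Longrightarrow> fourier_span S (\<lambda>u. \<Sum>i\<in>I. a i u)"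
  by (induction I rule: infinite_finite_induct) (auto intro: fourier_span_zero fourier_span.add)

lemma char_convolution:
  assumes "finite_borel_measure D" "finite_borel_measure E"
  shows "char (D \<star> E) t = char D t * char E t"
proof -
  interpret D: finite_borel_measure D by fact
  interpret E: finite_borel_measure E by fact
  interpret P: pair_sigma_finite D E ..
  interpret F: finite_measure "D \<Otimes>\<^sub>M E" 
    by (intro finite_measure_pair_measure D.finite_measure_axioms E.finite_measure_axioms)
  have [measurable_cong]: "sets D = sets borel" "sets E = sets borel"
    by (rule D.M_is_borel E.M_is_borel)+
  have "char (D \<star> E) t = (CLINT p|D \<Otimes>\<^sub>M E. iexp (t * (fst p + snd p)))"
    unfolding char_def convolution_def by (subst integral_distr) (auto simp: case_prod_beta)
  also have "\<dots> = (CLINT p|D \<Otimes>\<^sub>M E. (\<lambda>(x, y). iexp (t * x) * iexp (t * y)) p)"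
    by (intro Bochner_Integration.integral_cong refl) (auto simp: distrib_left exp_add)
  also have "\<dots> = (CLINT x|D. (CLINT y|E. iexp (t * x) * iexp (t * y)))"
    by (rule P.integral_fst[symmetric], rule F.integrable_const_bound[where B=1])
       (auto simp: norm_mult)
  also have "\<dots> = char D t * char E t" by (simp add: char_def)
  finally show ?thesis .
qed

text \<open>
  Bilinearity reduces to two generators, whose product is the transform of the convolution.
\<close>

lemma fourier_span_mult:
  assumes "fourier_span S a" "fourier_span R b"
    and sub: "\<And>x y. x \<in> S \<Longrightarrow> y \<in> R \<Longrightarrow> x + y \<in> U" and U: "U \<in> sets borel"
  shows "fourier_span U (\<lambda>u. a u * b u)"
  using assms(1)
proof (induction rule: fourier_span.induct)
  case (char D)
  note D = this
  show ?case using assms(2)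
  proof (induction rule: fourier_span.induct)
    case (char E)
    interpret D: finite_borel_measure D by fact
    interpret E: finite_borel_measure E by fact
    interpret P: pair_sigma_finite D E ..
    have [measurable_cong]: "sets D = sets borel" "sets E = sets borel"
      by (rule D.M_is_borel E.M_is_borel)+
    have [measurable]: "U \<in> sets borel" by fact
    have "finite_borel_measure (D \<star> E)"
      by (intro finite_borel_measure.intro convolution_finite)
         (auto simp: finite_borel_measure_axioms_def D.M_is_borel E.M_is_borel
           intro: D.finite_measure_axioms E.finite_measure_axioms)
    moreover have "AE x in D \<star> E. x \<in> U"
    proof -
      have "AE p in D \<Otimes>\<^sub>M E. fst p + snd p \<in> U"
      proof (rule P.AE_pair_measure)
        show "{p \<in> space (D \<Otimes>\<^sub>M E). fst p + snd p \<in> U} \<in> sets (D \<Otimes>\<^sub>M E)"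
          by measurable
        show "AE x in D. AE y in E. fst (x, y) + snd (x, y) \<in> U"
          using D(2)
        proof eventually_elim
          case (elim x)
          show ?case using char(2) by eventually_elim (use elim sub in auto)
        qed
      qed
      then show ?thesis unfolding convolution_def
        by (subst AE_distr_iff) (auto simp: case_prod_beta)
    qed
    ultimately have "fourier_span U (char (D \<star> E))" by (rule fourier_span.char)
    moreover have "char (D \<star> E) = (\<lambda>u. char D u * char E u)"
      using char_convolution D(1) char(1) by blast
    ultimately show ?case by simp
  next
    case (add a b)
    then show ?case using fourier_span.add by (simp add: distrib_left)
  next
    case (cmult b c)
    then show ?case using fourier_span.cmult[of U _ c] by (simp add: mult.left_commute)
  qed
next
  case (add a b)
  then show ?case using fourier_span.add by (simp add: distrib_right)
next
  case (cmult a c)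
  then show ?case using fourier_span.cmult[of U _ c] by (simp add: mult.assoc)
qed

lemma fourier_span_isCont: "fourier_span S a \<Longrightarrow> isCont a u"
proof (induction arbitrary: u rule: fourier_span.induct)
  case (char D)
  then show ?case using finite_borel_measure.isCont_char_finite by blast
qed (auto intro!: continuous_intros)

lemma set_integrable_hilbert_kernel:
  assumes "continuous_on UNIV h" "0 < \<epsilon>"
  shows "set_integrable lborel {\<epsilon>..A} (\<lambda>u. (h u - h (-u)) / complex_of_real u)"
proof (rule borel_integrable_atLeastAtMost')
  show "continuous_on {\<epsilon>..A} (\<lambda>u. (h u - h (-u)) / complex_of_real u)"
    using assms(2) by (intro continuous_intros continuous_on_compose2[OF assms(1)]) auto
qed

lemma trunc_hilbert_add:
  assumes "continuous_on UNIV h" "continuous_on UNIV k" "0 < \<epsilon>"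
  shows "trunc_hilbert (\<lambda>u. h u + k u) \<epsilon> A = trunc_hilbert h \<epsilon> A + trunc_hilbert k \<epsilon> A"
proof -
  have "(\<lambda>u. (h u + k u - (h (-u) + k (-u))) / complex_of_real u) =
        (\<lambda>u. (h u - h (-u)) / complex_of_real u + (k u - k (-u)) / complex_of_real u)"
    by (simp add: fun_eq_iff algebra_simps add_divide_distrib diff_divide_distrib)
  then show ?thesis unfolding trunc_hilbert_def
    using assms by (simp add: set_integral_add set_integrable_hilbert_kernel)
qed

lemma trunc_hilbert_cmult: "trunc_hilbert (\<lambda>u. c * h u) \<epsilon> A = c * trunc_hilbert h \<epsilon> A"
  unfolding trunc_hilbert_def set_integral_mult_right[symmetric]
  by (simp add: right_diff_distrib[symmetric])

lemma trunc_hilbert_const [simp]: "trunc_hilbert (\<lambda>u. c) \<epsilon> A = 0"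
  by (simp add: trunc_hilbert_def)

lemma tendsto_trunc_hilbert_add:
  assumes "continuous_on UNIV h" "continuous_on UNIV k"
    "((\<lambda>(\<epsilon>, A). trunc_hilbert h \<epsilon> A) \<longlongrightarrow> a) pv_filter"
    "((\<lambda>(\<epsilon>, A). trunc_hilbert k \<epsilon> A) \<longlongrightarrow> b) pv_filter"
  shows "((\<lambda>(\<epsilon>, A). trunc_hilbert (\<lambda>u. h u + k u) \<epsilon> A) \<longlongrightarrow> a + b) pv_filter"
  by (rule Lim_transform_eventually[OF tendsto_add[OF assms(3,4)]],
      rule eventually_mono[OF eventually_pv_filter])
     (auto simp: trunc_hilbert_add assms)

lemma tendsto_trunc_hilbert_cmult:
  assumes "((\<lambda>(\<epsilon>, A). trunc_hilbert h \<epsilon> A) \<longlongrightarrow> a) pv_filter"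
  shows "((\<lambda>(\<epsilon>, A). trunc_hilbert (\<lambda>u. c * h u) \<epsilon> A) \<longlongrightarrow> c * a) pv_filter"
  using tendsto_mult_left[OF assms, of c] by (simp add: trunc_hilbert_cmult split_def)

lemma fourier_span_shift_continuous: "fourier_span S a \<Longrightarrow> continuous_on UNIV (\<lambda>u. a (s + u))"
  by (rule continuous_on_compose2[of UNIV a])
     (auto intro!: continuous_at_imp_continuous_on fourier_span_isCont continuous_intros)

text \<open>
  On the positive half-line \<open>sgn x = 1\<close>, so the transform is multiplication by \<open>\<pi>i\<close>.
\<close>

lemma tendsto_trunc_hilbert_pos:
  "fourier_span {0<..} a \<Longrightarrow>
    ((\<lambda>(\<epsilon>, A). trunc_hilbert (\<lambda>u. a (s + u)) \<epsilon> A) \<longlongrightarrow> \<i> * pi * a s) pv_filter"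
proof (induction rule: fourier_span.induct)
  case (char D)
  interpret finite_borel_measure D by fact
  have "(CLINT x|D. iexp (s * x) * of_real (sgn x)) = char D s"
    unfolding char_def using char(2) by (intro integral_cong_AE borel_measurable_of_borel) (auto elim!: eventually_mono)
  then show ?case using tendsto_trunc_hilbert_char[of s] by simp
next
  case (add a b)
  then show ?case
    using tendsto_trunc_hilbert_add[OF fourier_span_shift_continuous fourier_span_shift_continuous] 
    by (simp add: distrib_left)
next
  case (cmult a c)
  then show ?case
    using tendsto_trunc_hilbert_cmult[of _ _ c] by (simp add: mult.left_commute)
qed

text \<open>
  On the nonpositive half-line \<open>sgn x = -1\<close> except at \<open>0\<close>; the constant \<open>c\<close> is the mass of the
  atom at \<open>0\<close>, whose Fourier transform is constant.
\<close>

lemma tendsto_trunc_hilbert_nonpos: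
  "fourier_span {..0} a \<Longrightarrow>
    \<exists>c. \<forall>s. ((\<lambda>(\<epsilon>, A). trunc_hilbert (\<lambda>u. a (s + u)) \<epsilon> A) \<longlongrightarrow> \<i> * pi * (c - a s)) pv_filter"
proof (induction rule: fourier_span.induct)
  case (char D)
  interpret finite_borel_measure D by fact
  let ?c = "CLINT x|D. of_real (indicator {0} x)"
  have "(CLINT x|D. iexp (s * x) * of_real (sgn x)) = ?c - char D s" for s
  proof -
    have "?c - char D s = (CLINT x|D. of_real (indicator {0} x) - iexp (s * x))"
      unfolding char_def
      by (rule Bochner_Integration.integral_diff[symmetric])
         (rule integrable_bounded_borel[where B=1]; simp add: indicator_def)+
    also have "\<dots> = (CLINT x|D. iexp (s * x) * of_real (sgn x))"
      using char(2) by (intro integral_cong_AE borel_measurable_of_borel)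
         (auto elim!: eventually_mono simp: sgn_if)
    finally show ?thesis ..
  qed
  then show ?case using tendsto_trunc_hilbert_char by (intro exI[of _ ?c]) simp
next
  case (add a b)
  then obtain c d where
    c: "\<And>s. ((\<lambda>(\<epsilon>, A). trunc_hilbert (\<lambda>u. a (s + u)) \<epsilon> A) \<longlongrightarrow> \<i> * pi * (c - a s)) pv_filter" and
    d: "\<And>s. ((\<lambda>(\<epsilon>, A). trunc_hilbert (\<lambda>u. b (s + u)) \<epsilon> A) \<longlongrightarrow> \<i> * pi * (d - b s)) pv_filter"
    by blast
  have "\<i> * pi * (c - a s) + \<i> * pi * (d - b s) = \<i> * pi * (c + d - (a s + b s))" for s
    by (simp add: algebra_simps)
  moreover have "((\<lambda>(\<epsilon>, A). trunc_hilbert (\<lambda>u. a (s + u) + b (s + u)) \<epsilon> A) \<longlongrightarrow>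
      \<i> * pi * (c - a s) + \<i> * pi * (d - b s)) pv_filter" for s
    by (rule tendsto_trunc_hilbert_add[OF _ _ c d]; rule fourier_span_shift_continuous; fact)
  ultimately show ?case by (intro exI[of _ "c + d"]) simp
next
  case (cmult a d)
  then obtain c where
    c: "\<And>s. ((\<lambda>(\<epsilon>, A). trunc_hilbert (\<lambda>u. a (s + u)) \<epsilon> A) \<longlongrightarrow> \<i> * pi * (c - a s)) pv_filter" by blast
  have eq: "d * (\<i> * pi * (c - a s)) = \<i> * pi * (d * c - d * a s)" for s
    by (simp add: algebra_simps)
  have "((\<lambda>(\<epsilon>, A). trunc_hilbert (\<lambda>u. d * a (s + u)) \<epsilon> A) \<longlongrightarrow>
      \<i> * pi * (d * c - d * a s)) pv_filter" for s
    using tendsto_trunc_hilbert_cmult[OF c[of s], of d] unfolding eq .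
  then show ?case by blast
qed

text \<open>
  Comparing the two evaluations of the transform gives \<open>2 a(s) = c\<close> for all \<open>s\<close>, so \<open>a\<close> is constant.
  The transform of a constant vanishes, whereas it is also \<open>\<pi>i a(s)\<close>.
\<close>

lemma fourier_span_pos_nonpos_eq_0:
  assumes "fourier_span {0<..} a" "fourier_span {..0} a"
  shows "a s = 0"
proof -
  note pos = tendsto_trunc_hilbert_pos[OF assms(1)]
  obtain c where c: "\<And>s. ((\<lambda>(\<epsilon>, A). trunc_hilbert (\<lambda>u. a (s + u)) \<epsilon> A) \<longlongrightarrow> \<i> * pi * (c - a s)) pv_filter"
    using tendsto_trunc_hilbert_nonpos[OF assms(2)] by blast
  have "a = (\<lambda>_. c / 2)"
  proof
    fix s
    have "\<i> * pi * a s = \<i> * pi * (c - a s)"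
      by (rule tendsto_unique[OF pv_filter_nonbot pos c])
    then show "a s = c / 2" by (simp add: field_simps)
  qed
  with pos[of s] have "((\<lambda>_. 0) \<longlongrightarrow> \<i> * pi * a s) pv_filter" by (simp add: split_def)
  from tendsto_unique[OF pv_filter_nonbot this tendsto_const] show ?thesis by simp
qed

text \<open>
  The measure is the law of \<open>Y\<close> under the restriction of the probability to \<open>E\<close>.
\<close>

lemma (in prob_space) fourier_span_expectation:
  fixes Y :: "'a \<Rightarrow> real"
  assumes [measurable]: "Y \<in> borel_measurable M" "E \<in> sets M" and sub: "\<And>\<omega>. \<omega> \<in> E \<Longrightarrow> Y \<omega> \<in> S"
    and [measurable]: "S \<in> sets borel"
  shows "fourier_span S (\<lambda>u. CLINT \<omega>|M. indicator E \<omega> *\<^sub>R iexp (u * Y \<omega>))"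
proof -
  let ?N = "density M (\<lambda>\<omega>. ennreal (indicator E \<omega>))"
  have "finite_measure ?N"
    unfolding ennreal_indicator by (rule finite_measure_restricted) measurable
  then have "finite_measure (distr ?N borel Y)"
    by (rule finite_measure.finite_measure_distr) measurable
  then have "finite_borel_measure (distr ?N borel Y)"
    by (simp add: finite_borel_measure.intro finite_borel_measure_axioms_def)
  moreover have "AE x in distr ?N borel Y. x \<in> S"
    by (subst AE_distr_iff) (auto simp: AE_density sub indicator_def)
  ultimately have "fourier_span S (char (distr ?N borel Y))" by (rule fourier_span.char)
  moreover have "char (distr ?N borel Y) = (\<lambda>u. CLINT \<omega>|M. indicator E \<omega> *\<^sub>R iexp (u * Y \<omega>))"
    by (auto simp: char_def integral_distr integral_density)
  ultimately show ?thesis by simp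
qed

section \<open>Uniqueness of the Wiener-Hopf factorization\<close>

unbundle no vec_syntax
unbundle fps_syntax

text \<open>
  The formal series of \<open>exp (\<Sum>\<^sub>k\<^sub>\<ge>\<^sub>1 p\<^sub>k X\<^sup>k / k)\<close>; the term \<open>k = 0\<close> disappears because \<open>p\<^sub>0 / 0 = 0\<close>.
\<close>

definition exp_series :: "(nat \<Rightarrow> complex) \<Rightarrow> complex fps" where
  "exp_series p = fps_exp 1 oo Abs_fps (\<lambda>k. p k / of_nat k)"

lemma exp_series_nth_0 [simp]: "exp_series p $ 0 = 1"
  by (simp add: exp_series_def)

lemma fps_deriv_coeffs_over_index:
  "fps_deriv (Abs_fps (\<lambda>k. p k / of_nat k)) = Abs_fps (\<lambda>k. p (Suc k) :: complex)"
  by (simp add: fps_eq_iff del: of_nat_Suc)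

lemma deriv_exp_series: "fps_deriv (exp_series p) = exp_series p * Abs_fps (\<lambda>k. p (Suc k))"
  unfolding exp_series_def by (simp add: fps_compose_deriv fps_deriv_coeffs_over_index)

text \<open>
  Comparing coefficients in \<open>E' = L' E\<close> for \<open>E = exp L\<close>. The recursion uses only sums, products and scalars, so it
  carries support properties of the \<open>p\<^sub>k\<close> over to the coefficients of the exponential.
\<close>

lemma exp_series_nth_Suc:
  "exp_series p $ Suc n = (\<Sum>i=0..n. 1 / of_nat (Suc n) * (exp_series p $ i * p (Suc (n - i))))"
proof -
  have "of_nat (Suc n) * exp_series p $ Suc n = fps_deriv (exp_series p) $ n" by simp
  also have "\<dots> = (\<Sum>i=0..n. exp_series p $ i * p (Suc (n - i)))"
    by (simp add: deriv_exp_series fps_mult_nth)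
  finally have eq: "of_nat (Suc n) * exp_series p $ Suc n = (\<Sum>i=0..n. exp_series p $ i * p (Suc (n - i)))" .
  show ?thesis
    unfolding sum_distrib_left[symmetric] eq[symmetric] by (simp del: of_nat_Suc)
qed

text \<open>
  This is \<open>exp (\<Sum>\<^sub>k c\<^sup>k X\<^sup>k / k) = 1 / (1 - c X)\<close>: the logarithmic derivative of the left-hand side is
  \<open>c / (1 - c X)\<close>, so its product with \<open>1 - c X\<close> has derivative \<open>0\<close> and constant term \<open>1\<close>.
\<close>

lemma exp_series_mult_eq_geometric:
  assumes "\<And>k. k > 0 \<Longrightarrow> p k + q k = c ^ k"
  shows "(exp_series p * exp_series q) $ n = c ^ n"
proof -
  let ?G = "exp_series p * exp_series q" and ?F = "Abs_fps (\<lambda>k. c ^ Suc k)"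
  have "Abs_fps (\<lambda>k. p (Suc k)) + Abs_fps (\<lambda>k. q (Suc k)) = ?F"
    using assms by (simp add: fps_eq_iff)
  then have dG: "fps_deriv ?G = ?F * ?G"
    by (simp add: deriv_exp_series algebra_simps flip: distrib_left)
  have F: "(1 - fps_const c * fps_X) * ?F = fps_const c"
  proof (rule fps_ext)
    fix n show "((1 - fps_const c * fps_X) * ?F) $ n = fps_const c $ n"
      by (cases n) (simp_all add: left_diff_distrib mult.assoc)
  qed
  have "fps_deriv ((1 - fps_const c * fps_X) * ?G) = ((1 - fps_const c * fps_X) * ?F - fps_const c) * ?G"
  proof -
    \<comment> \<open>\<open>K\<close> keeps the simplifier from multiplying out \<open>1 - c X\<close>.\<close>
    define K where "K = 1 - fps_const c * fps_X"
    have "fps_deriv K = - fps_const c" by (simp add: K_def)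
    then have "fps_deriv (K * ?G) = K * (?F * ?G) + (- fps_const c) * ?G"
      by (simp only: fps_deriv_mult[of K] dG)
    then show ?thesis unfolding K_def[symmetric] 
      by (simp only: distrib_right mult.assoc mult_minus_left diff_conv_add_uminus)
  qed
  then have "(1 - fps_const c * fps_X) * ?G = fps_const (((1 - fps_const c * fps_X) * ?G) $ 0)"
    unfolding F by (simp only: fps_deriv_eq_0_iff diff_self mult_zero_left)
  then have *: "(1 - fps_const c * fps_X) * ?G = 1" by simp
  show ?thesis
  proof (induction n)
    case (Suc n)
    have "((1 - fps_const c * fps_X) * ?G) $ Suc n = ?G $ Suc n - c * ?G $ n"
      by (simp add: left_diff_distrib mult.assoc del: fps_mult_nth_conv_upto_subdegree_left)
    with Suc * show ?case by simp
  qed simp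
qed

lemma fourier_span_exp_series:
  assumes p: "\<And>k. k > 0 \<Longrightarrow> fourier_span S (\<lambda>u. p u k)" and "n > 0"
    and S: "\<And>x y. x \<in> S \<Longrightarrow> y \<in> S \<Longrightarrow> x + y \<in> S" "S \<in> sets borel"
  shows "fourier_span S (\<lambda>u. exp_series (p u) $ n)"
  using \<open>n > 0\<close>
proof (induction n rule: less_induct)
  case (less n)
  then obtain m where n: "n = Suc m" by (cases n) auto
  have "fourier_span S (\<lambda>u. exp_series (p u) $ i * p u (Suc (m - i)))" if "i \<in> {0..m}" for i
  proof (cases "i = 0")
    case True
    then show ?thesis using p[of "Suc m"] by simp
  next
    case False
    then show ?thesis using that n less.IH[of i] p S
      by (intro fourier_span_mult[where S=S and R=S]) auto
  qed
  then show ?case unfolding n exp_series_nth_Suc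
    by (intro fourier_span_sum fourier_span.cmult)
qed

text \<open>
  Both pairs of series multiply to \<open>1/(1 - f X)\<close>. If they agree below degree \<open>n\<close>, the
  coefficients of degree \<open>n\<close> have equal sums, because the constant coefficients are \<open>1\<close>. Hence the
  difference of the two first factors in degree \<open>n\<close> is carried by the positive half-line and, being minus the
  difference of the second factors, also by the nonpositive one; so it is zero.
\<close>

theorem factorization_unique:
  fixes \<alpha> \<beta> p q :: "real \<Rightarrow> nat \<Rightarrow> complex"
  assumes \<alpha>0: "\<And>u. \<alpha> u 0 = 1" and \<beta>0: "\<And>u. \<beta> u 0 = 1"
    and \<alpha>: "\<And>n. n > 0 \<Longrightarrow> fourier_span {0<..} (\<lambda>u. \<alpha> u n)"
    and \<beta>: "\<And>n. n > 0 \<Longrightarrow> fourier_span {..0} (\<lambda>u. \<beta> u n)"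
    and p: "\<And>n. n > 0 \<Longrightarrow> fourier_span {0<..} (\<lambda>u. p u n)"
    and q: "\<And>n. n > 0 \<Longrightarrow> fourier_span {..0} (\<lambda>u. q u n)"
    and pq: "\<And>n u. n > 0 \<Longrightarrow> p u n + q u n = f u ^ n"
    and \<alpha>\<beta>: "\<And>n u. (\<Sum>k=0..n. \<alpha> u k * \<beta> u (n - k)) = f u ^ n"
  shows "\<alpha> u n = exp_series (p u) $ n \<and> \<beta> u n = exp_series (q u) $ n"
proof (induction n arbitrary: u rule: less_induct)
  case (less n)
  show ?case
  proof (cases "n = 0")
    case True
    then show ?thesis by (simp add: \<alpha>0 \<beta>0)
  next
    case False
    let ?a = "\<lambda>u. exp_series (p u)" and ?b = "\<lambda>u. exp_series (q u)"
    have split: "(\<Sum>k=0..n. x k * y (n - k)) = x 0 * y n + (\<Sum>k\<in>{1..<n}. x k * y (n - k)) + x n * y 0"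
      for x y :: "nat \<Rightarrow> complex"
    proof -
      have "{0..n} = insert 0 (insert n {1..<n})" using False by auto
      then show ?thesis using False by simp
    qed
    have sum_eq: "\<alpha> u n - ?a u $ n = ?b u $ n - \<beta> u n" for u
    proof -
      have "(\<Sum>k=0..n. \<alpha> u k * \<beta> u (n - k)) = (\<Sum>k=0..n. ?a u $ k * ?b u $ (n - k))"
        using \<alpha>\<beta> exp_series_mult_eq_geometric[OF pq] by (simp add: fps_mult_nth)
      moreover have "(\<Sum>k\<in>{1..<n}. \<alpha> u k * \<beta> u (n - k)) = (\<Sum>k\<in>{1..<n}. ?a u $ k * ?b u $ (n - k))"
        by (intro sum.cong refl) (use less in auto)
      ultimately show ?thesis unfolding split by (simp add: \<alpha>0 \<beta>0 algebra_simps)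
    qed
    have "fourier_span {0<..} (\<lambda>u. \<alpha> u n - ?a u $ n)"
      using False by (intro fourier_span_diff \<alpha> fourier_span_exp_series p) auto
    moreover have "fourier_span {..0} (\<lambda>u. \<alpha> u n - ?a u $ n)"
      unfolding sum_eq using False by (intro fourier_span_diff \<beta> fourier_span_exp_series q) auto
    ultimately have "\<alpha> u n - ?a u $ n = 0" by (rule fourier_span_pos_nonpos_eq_0)
    with sum_eq[of u] show ?thesis by auto
  qed
qed

lemma conv_radius_ge_1:
  assumes "\<And>n. norm (a n) \<le> (1::real)"
  shows "conv_radius (a :: nat \<Rightarrow> complex) \<ge> 1"
proof (rule conv_radius_geI_ex')
  fix r :: real assume r: "0 < r" "ereal r < 1"
  show "summable (\<lambda>n. a n * of_real r ^ n)"
  proof (rule summable_comparison_test')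
    show "summable (\<lambda>n. r ^ n)" using r by (intro summable_geometric) auto
    show "norm (a n * of_real r ^ n) \<le> r ^ n" for n
      using assms[of n] r by (simp add: norm_mult norm_power mult_left_le_one_le)
  qed
qed

text \<open>
  Inside the unit disc \<open>A exp(-L)\<close> has derivative \<open>0\<close>, where \<open>A\<close> and \<open>L\<close> are the sums of the formal
  exponential and of its exponent. The bounds on the coefficients make both converge there.
\<close>

lemma exp_series_sums:
  assumes a: "\<And>n. norm (exp_series p $ n) \<le> 1" and p: "\<And>k. norm (p k) \<le> 1" and z: "norm z < 1"
  shows "(\<lambda>n. exp_series p $ n * z ^ n) sums exp (\<Sum>k. p k / of_nat k * z ^ k)"
proof -
  define L where "L = Abs_fps (\<lambda>k. p k / of_nat k)"
  have "norm (p k / of_nat k) \<le> 1" for k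
    using p[of k] by (cases "k = 0") (auto simp: norm_divide divide_le_eq)
  then have rL: "fps_conv_radius L \<ge> 1"
    unfolding L_def fps_conv_radius_def by (simp add: conv_radius_ge_1)
  have rA: "fps_conv_radius (exp_series p) \<ge> 1"
    unfolding fps_conv_radius_def by (intro conv_radius_ge_1 a)
  have rL': "fps_conv_radius (fps_deriv L) \<ge> 1"
    using rL fps_conv_radius_deriv order_trans by blast
  have dA: "fps_deriv (exp_series p) = exp_series p * fps_deriv L"
    unfolding deriv_exp_series L_def fps_deriv_coeffs_over_index ..
  have lt: "ereal (norm w) < fps_conv_radius F" if "w \<in> ball 0 1" "fps_conv_radius F \<ge> 1" for F and w :: complex
  proof -
    have "ereal (norm w) < 1" using that(1) by (simp add: one_ereal_def)
    then show ?thesis using that(2) by (rule less_le_trans)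
  qed
  let ?h = "\<lambda>w. eval_fps (exp_series p) w * exp (- eval_fps L w)"
  have "\<exists>c. \<forall>w\<in>ball 0 1. ?h w = c"
  proof (rule has_field_derivative_zero_constant)
    fix w :: complex assume w: "w \<in> ball 0 1"
    have 1: "(eval_fps (exp_series p) has_field_derivative eval_fps (exp_series p) w * eval_fps (fps_deriv L) w)
       (at w within ball 0 1)"
      using has_field_derivative_eval_fps[OF lt[OF w rA], of "ball 0 1"]
      unfolding dA by (simp add: eval_fps_mult lt[OF w rA] lt[OF w rL'])
    have 2: "(eval_fps L has_field_derivative eval_fps (fps_deriv L) w) (at w within ball 0 1)"
      by (rule has_field_derivative_eval_fps[OF lt[OF w rL]])
    show "(?h has_field_derivative 0) (at w within ball 0 1)"
      by (rule derivative_eq_intros 1 2 refl)+ (simp add: algebra_simps)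
  qed simp
  then obtain c where c: "\<And>w. w \<in> ball 0 1 \<Longrightarrow> ?h w = c" by blast
  have "c = 1" using c[of 0] by (simp add: eval_fps_at_0 L_def)
  then have "eval_fps (exp_series p) z = exp (eval_fps L z)"
    using c[of z] z by (simp add: exp_minus field_simps)
  moreover have "(\<lambda>n. exp_series p $ n * z ^ n) sums eval_fps (exp_series p) z"
    using z by (intro sums_eval_fps lt rA) auto
  ultimately show ?thesis by (simp add: eval_fps_def L_def)
qed

section \<open>The decomposition at the maximum and Spitzer's identity\<close>

abbreviation psum :: "(nat \<Rightarrow> real) \<Rightarrow> nat \<Rightarrow> real" where
  "psum x n \<equiv> (\<Sum>j=1..n. x j)"

text \<open>
  The part of \<open>exp(iuS\<^sub>k)\<close> on which time \<open>k\<close> is a strict record.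
\<close>

definition record_term :: "nat \<Rightarrow> real \<Rightarrow> (nat \<Rightarrow> real) \<Rightarrow> complex" where
  "record_term k u x = (if \<forall>j\<in>{..<k}. psum x j < psum x k then iexp (u * psum x k) else 0)"

definition stay_nonpos_term :: "nat \<Rightarrow> real \<Rightarrow> (nat \<Rightarrow> real) \<Rightarrow> complex" where
  "stay_nonpos_term m u x = (if \<forall>j\<in>{..m}. psum x j \<le> 0 then iexp (u * psum x m) else 0)"

lemma psum_shift: "psum (\<lambda>j. x (j + k)) m = psum x (k + m) - psum x k"
  by (induction m) (auto simp: add.commute)

text \<open>
  Exactly one summand is nonzero, namely that of the first time \<open>K\<close> at which the maximum is
  attained: before \<open>K\<close> all partial sums are strictly smaller, and the path restarted at \<open>K\<close> never becomes
  positive. A time before \<open>K\<close> fails the second requirement, a time after \<open>K\<close> the first.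
\<close>

lemma exp_max_decomposition:
  fixes x :: "nat \<Rightarrow> real" and n :: nat
  defines "m \<equiv> Max (psum x ` {0..n})"
  shows "exp (\<i> * of_real (s * m + t * (m - psum x n))) =
    (\<Sum>k=0..n. record_term k s x * stay_nonpos_term (n - k) (- t) (\<lambda>j. x (j + k)))"
proof -
  have ge: "psum x j \<le> m" if "j \<le> n" for j unfolding m_def using that by auto
  have "m \<in> psum x ` {0..n}" unfolding m_def by (rule Max_in) auto
  then have ex: "\<exists>k. k \<le> n \<and> psum x k = m" by auto
  \<comment> \<open>Ties at the maximum are broken in favour of the earliest time.\<close>
  define K where "K = (LEAST k. k \<le> n \<and> psum x k = m)"
  have K: "K \<le> n" "psum x K = m" using LeastI_ex[OF ex] unfolding K_def by auto
  have lt: "psum x j < m" if "j < K" for j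
    using not_less_Least[of j "\<lambda>k. k \<le> n \<and> psum x k = m"] ge[of j] that K(1)
    unfolding K_def[symmetric] by force
  let ?F = "\<lambda>k. record_term k s x * stay_nonpos_term (n - k) (- t) (\<lambda>j. x (j + k))"
  have zero: "?F k = 0" if "k \<in> {0..n} - {K}" for k
  proof (cases "k < K")
    case True
    then have "psum (\<lambda>j. x (j + k)) (K - k) > 0" "K - k \<le> n - k"
      unfolding psum_shift using lt[of k] K by auto
    then have "stay_nonpos_term (n - k) (- t) (\<lambda>j. x (j + k)) = 0"
      unfolding stay_nonpos_term_def by (auto simp: not_le intro!: bexI[of _ "K - k"])
    then show ?thesis by simp
  next
    case False
    then have "K < k" "psum x k \<le> psum x K" using that ge[of k] K by auto
    then have "record_term k s x = 0"
      unfolding record_term_def by (auto simp: not_less intro!: bexI[of _ K])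
    then show ?thesis by simp
  qed
  have "(\<Sum>k=0..n. ?F k) = (\<Sum>k\<in>{K}. ?F k)"
    by (rule sum.mono_neutral_right) (use zero K in auto)
  moreover have "record_term K s x = iexp (s * m)"
    unfolding record_term_def using lt K by auto
  moreover have "stay_nonpos_term (n - K) (- t) (\<lambda>j. x (j + K)) = iexp (- t * (psum x n - m))"
    unfolding stay_nonpos_term_def psum_shift using ge K by auto
  moreover have "iexp (s * m) * iexp (- t * (psum x n - m)) =
      exp (\<i> * of_real (s * m + t * (m - psum x n)))"
    unfolding exp_add[symmetric] by (intro arg_cong[where f=exp]) (simp add: algebra_simps)
  ultimately show ?thesis by simp
qed

lemma measurable_psum:
  assumes "\<And>j. j \<in> {1..n} \<Longrightarrow> (\<lambda>w. x w j) \<in> borel_measurable N"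
  shows "(\<lambda>w. psum (x w) n) \<in> borel_measurable N"
  by (intro borel_measurable_sum assms)

lemma measurable_record_term:
  assumes "\<And>j. j \<in> {1..k} \<Longrightarrow> (\<lambda>w. x w j) \<in> borel_measurable N"
  shows "(\<lambda>w. record_term k u (x w)) \<in> borel_measurable N"
proof -
  have P: "(\<lambda>w. psum (x w) j) \<in> borel_measurable N" if "j \<le> k" for j
    using that by (intro measurable_psum assms) auto
  have "Measurable.pred N (\<lambda>w. \<forall>j\<in>{..<k}. psum (x w) j < psum (x w) k)"
    by (intro pred_intros_finite borel_measurable_pred_less P) auto
  moreover have "(\<lambda>w. iexp (u * psum (x w) k)) \<in> borel_measurable N"
    by (rule measurable_compose[OF P[OF order_refl]]) measurable
  ultimately show ?thesis
    unfolding record_term_def pred_def by (intro measurable_If borel_measurable_const)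
qed

lemma measurable_stay_nonpos_term:
  assumes "\<And>j. j \<in> {1..m} \<Longrightarrow> (\<lambda>w. x w j) \<in> borel_measurable N"
  shows "(\<lambda>w. stay_nonpos_term m u (x w)) \<in> borel_measurable N"
proof -
  have P: "(\<lambda>w. psum (x w) j) \<in> borel_measurable N" if "j \<le> m" for j
    using that by (intro measurable_psum assms) auto
  have "Measurable.pred N (\<lambda>w. psum (x w) j \<le> 0)" if "j \<in> {..m}" for j
    unfolding pred_def by (intro borel_measurable_le P borel_measurable_const) (use that in simp)
  then have "Measurable.pred N (\<lambda>w. \<forall>j\<in>{..m}. psum (x w) j \<le> 0)"
    by (intro pred_intros_finite) auto
  moreover have "(\<lambda>w. iexp (u * psum (x w) m)) \<in> borel_measurable N"
    by (rule measurable_compose[OF P[OF order_refl]]) measurable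
  ultimately show ?thesis
    unfolding stay_nonpos_term_def pred_def by (intro measurable_If borel_measurable_const)
qed

lemma norm_record_term_le: "norm (record_term k u x) \<le> 1"
  by (simp add: record_term_def)

lemma norm_stay_nonpos_term_le: "norm (stay_nonpos_term k u x) \<le> 1"
  by (simp add: stay_nonpos_term_def)

locale iid_steps = prob_space M for M :: "'a measure" +
  fixes X :: "nat \<Rightarrow> 'a \<Rightarrow> real"
  assumes indep: "indep_vars (\<lambda>_. borel) X UNIV"
    and ident: "distr M borel (X j) = distr M borel (X 0)"
begin

lemma measurable_X [measurable]: "X j \<in> borel_measurable M"
  using indep unfolding indep_vars_def2 by simp

definition step_cf :: "real \<Rightarrow> complex" where "step_cf = char (distr M borel (X 0))"

lemma distr_shift:
  "distr M (Pi\<^sub>M UNIV (\<lambda>_. borel)) (\<lambda>\<omega> j. X (j + k) \<omega>) = Pi\<^sub>M UNIV (\<lambda>_. distr M borel (X 0))"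
proof -
  \<comment> \<open>Grouping into the singletons \<open>{j + k}\<close> reindexes the family.\<close>
  have "indep_vars (\<lambda>j. Pi\<^sub>M {j + k} (\<lambda>_. borel)) (\<lambda>j \<omega>. restrict (\<lambda>i. X i \<omega>) {j + k}) UNIV"
    by (rule indep_vars_restrict[OF indep]) (auto simp: disjoint_family_on_def)
  then have "indep_vars (\<lambda>_. borel) (\<lambda>j \<omega>. (\<lambda>x. x (j + k)) (restrict (\<lambda>i. X i \<omega>) {j + k})) UNIV"
    by (rule indep_vars_compose2) (auto intro: measurable_component_singleton)
  then have "indep_vars (\<lambda>_. borel) (\<lambda>j. X (j + k)) UNIV" by simp
  then have "distr M (Pi\<^sub>M UNIV (\<lambda>_. borel)) (\<lambda>\<omega>. \<lambda>j\<in>UNIV. X (j + k) \<omega>) =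
      Pi\<^sub>M UNIV (\<lambda>j. distr M borel (X (j + k)))"
    by (subst (asm) indep_vars_iff_distr_eq_PiM) auto
  then show ?thesis by (simp add: restrict_UNIV ident[of "_ + k"])
qed

lemma expectation_shift:
  fixes g :: "(nat \<Rightarrow> real) \<Rightarrow> complex"
  assumes [measurable]: "g \<in> borel_measurable (Pi\<^sub>M UNIV (\<lambda>_. borel))"
  shows "(CLINT \<omega>|M. g (\<lambda>j. X (j + k) \<omega>)) = (CLINT \<omega>|M. g (\<lambda>j. X j \<omega>))"
proof -
  have [measurable]: "(\<lambda>\<omega> j. X (j + k) \<omega>) \<in> measurable M (Pi\<^sub>M UNIV (\<lambda>_. borel))" for k
    by (rule measurable_PiM_single') (auto simp: PiE_UNIV_domain)
  have "(CLINT \<omega>|M. g (\<lambda>j. X (j + k) \<omega>)) =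
      integral\<^sup>L (distr M (Pi\<^sub>M UNIV (\<lambda>_. borel)) (\<lambda>\<omega> j. X (j + k) \<omega>)) g" for k
    by (rule integral_distr[symmetric]) measurable
  from this[of k] this[of 0] show ?thesis unfolding distr_shift by simp
qed

definition record_cf :: "real \<Rightarrow> nat \<Rightarrow> complex" where
  "record_cf u k = (CLINT \<omega>|M. record_term k u (\<lambda>j. X j \<omega>))"

definition stay_nonpos_cf :: "real \<Rightarrow> nat \<Rightarrow> complex" where
  "stay_nonpos_cf u m = (CLINT \<omega>|M. stay_nonpos_term m u (\<lambda>j. X j \<omega>))"

lemma integrable_bounded:
  fixes g :: "'a \<Rightarrow> complex"
  assumes "g \<in> borel_measurable M" "\<And>\<omega>. norm (g \<omega>) \<le> 1"
  shows "integrable M g"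
  by (rule integrable_const_bound[of _ 1]) (use assms in auto)

lemma norm_expectation_le_1:
  fixes g :: "'a \<Rightarrow> complex"
  assumes "\<And>\<omega>. norm (g \<omega>) \<le> 1"
  shows "norm (CLINT \<omega>|M. g \<omega>) \<le> 1"
proof -
  have "norm (CLINT \<omega>|M. g \<omega>) \<le> (LINT \<omega>|M. norm (g \<omega>))" by (rule integral_norm_bound)
  also have "\<dots> \<le> (LINT \<omega>|M. 1)" by (rule Bochner_Integration.integral_mono') (auto simp: assms)
  finally show ?thesis by (simp add: prob_space)
qed

text \<open>
  The first factor depends on the steps up to \<open>k\<close>, the second on the steps after \<open>k\<close>.
\<close>

lemma expectation_record_stay_nonpos:
  "(CLINT \<omega>|M. record_term k s (\<lambda>j. X j \<omega>) * stay_nonpos_term m t (\<lambda>j. X (j + k) \<omega>)) =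
     record_cf s k * stay_nonpos_cf t m"
proof -
  have "indep_var (Pi\<^sub>M {..k} (\<lambda>_. borel)) (\<lambda>\<omega>. restrict (\<lambda>i. X i \<omega>) {..k})
      (Pi\<^sub>M {k<..} (\<lambda>_. borel)) (\<lambda>\<omega>. restrict (\<lambda>i. X i \<omega>) {k<..})"
    by (rule indep_var_restrict[OF indep]) auto
  then have "indep_var borel (record_term k s \<circ> (\<lambda>\<omega>. restrict (\<lambda>i. X i \<omega>) {..k}))
      borel ((\<lambda>x. stay_nonpos_term m t (\<lambda>j. x (j + k))) \<circ> (\<lambda>\<omega>. restrict (\<lambda>i. X i \<omega>) {k<..}))"
    by (rule indep_var_compose)
       (auto intro!: measurable_record_term measurable_stay_nonpos_term measurable_component_singleton)
  also have "record_term k s \<circ> (\<lambda>\<omega>. restrict (\<lambda>i. X i \<omega>) {..k}) = (\<lambda>\<omega>. record_term k s (\<lambda>j. X j \<omega>))"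
    by (auto simp: fun_eq_iff record_term_def)
  also have "(\<lambda>x. stay_nonpos_term m t (\<lambda>j. x (j + k))) \<circ> (\<lambda>\<omega>. restrict (\<lambda>i. X i \<omega>) {k<..}) =
      (\<lambda>\<omega>. stay_nonpos_term m t (\<lambda>j. X (j + k) \<omega>))"
    by (auto simp: fun_eq_iff stay_nonpos_term_def)
  finally have "(CLINT \<omega>|M. record_term k s (\<lambda>j. X j \<omega>) * stay_nonpos_term m t (\<lambda>j. X (j + k) \<omega>)) =
     (CLINT \<omega>|M. record_term k s (\<lambda>j. X j \<omega>)) * (CLINT \<omega>|M. stay_nonpos_term m t (\<lambda>j. X (j + k) \<omega>))"
    by (rule indep_var_lebesgue_integral)
       (auto intro!: integrable_bounded measurable_record_term measurable_stay_nonpos_term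
         norm_record_term_le norm_stay_nonpos_term_le)
  also have "(CLINT \<omega>|M. stay_nonpos_term m t (\<lambda>j. X (j + k) \<omega>)) = stay_nonpos_cf t m"
    unfolding stay_nonpos_cf_def
    by (rule expectation_shift) (auto intro!: measurable_stay_nonpos_term measurable_component_singleton)
  finally show ?thesis by (simp add: record_cf_def)
qed

theorem joint_cf_decomposition:
  "joint_cf M X n s t = (\<Sum>k=0..n. record_cf s k * stay_nonpos_cf (- t) (n - k))"
proof -
  have "joint_cf M X n s t = (CLINT \<omega>|M. (\<Sum>k=0..n. record_term k s (\<lambda>j. X j \<omega>) *
      stay_nonpos_term (n - k) (- t) (\<lambda>j. X (j + k) \<omega>)))"
    unfolding joint_cf_def walk_max_def walk_def
    using exp_max_decomposition[of s _ _ t] by simp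
  also have "\<dots> = (\<Sum>k=0..n. CLINT \<omega>|M. record_term k s (\<lambda>j. X j \<omega>) *
      stay_nonpos_term (n - k) (- t) (\<lambda>j. X (j + k) \<omega>))"
  proof (rule Bochner_Integration.integral_sum)
    fix k
    have "norm (record_term k s (\<lambda>j. X j \<omega>) * stay_nonpos_term (n - k) (- t) (\<lambda>j. X (j + k) \<omega>)) \<le> 1" for \<omega>
      unfolding norm_mult by (intro mult_le_one norm_record_term_le norm_stay_nonpos_term_le norm_ge_zero)
    then show "integrable M (\<lambda>\<omega>. record_term k s (\<lambda>j. X j \<omega>) * stay_nonpos_term (n - k) (- t) (\<lambda>j. X (j + k) \<omega>))"
      by (intro integrable_bounded borel_measurable_times measurable_record_term measurable_stay_nonpos_term) auto
  qed
  finally show ?thesis by (simp add: expectation_record_stay_nonpos)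
qed

definition pos_cf :: "real \<Rightarrow> nat \<Rightarrow> complex" where
  "pos_cf u k = (CLINT \<omega>|M. indicator {\<omega>\<in>space M. walk X k \<omega> > 0} \<omega> *\<^sub>R iexp (u * walk X k \<omega>))"

definition nonpos_cf :: "real \<Rightarrow> nat \<Rightarrow> complex" where
  "nonpos_cf u k = (CLINT \<omega>|M. indicator {\<omega>\<in>space M. walk X k \<omega> \<le> 0} \<omega> *\<^sub>R iexp (u * walk X k \<omega>))"

lemma measurable_walk [measurable]: "walk X k \<in> borel_measurable M"
  unfolding walk_def[abs_def] by measurable

lemma char_walk: "char (distr M borel (walk X n)) u = step_cf u ^ n"
proof -
  have "indep_vars (\<lambda>_. borel) X {1..n}" by (rule indep_vars_subset[OF indep]) auto
  from char_distr_sum[OF this, of u]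
  have "char (distr M borel (walk X n)) u = (\<Prod>i=1..n. char (distr M borel (X i)) u)"
    unfolding walk_def[abs_def] .
  also have "\<dots> = (\<Prod>i=1..n. step_cf u)"
    unfolding step_cf_def by (intro prod.cong refl) (subst ident, rule refl)
  finally show ?thesis by simp
qed

lemma expectation_iexp_walk: "(CLINT \<omega>|M. iexp (u * walk X n \<omega>)) = step_cf u ^ n"
  unfolding char_walk[symmetric] char_def by (subst integral_distr) auto

lemma pos_cf_add_nonpos_cf: "pos_cf u n + nonpos_cf u n = step_cf u ^ n"
proof -
  have "pos_cf u n + nonpos_cf u n =
    (CLINT \<omega>|M. indicator {\<omega>\<in>space M. walk X n \<omega> > 0} \<omega> *\<^sub>R iexp (u * walk X n \<omega>) +
       indicator {\<omega>\<in>space M. walk X n \<omega> \<le> 0} \<omega> *\<^sub>R iexp (u * walk X n \<omega>))"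
    unfolding pos_cf_def nonpos_cf_def
    by (rule Bochner_Integration.integral_add[symmetric];
        intro integrable_bounded; (measurable | simp add: indicator_def))
  also have "\<dots> = (CLINT \<omega>|M. iexp (u * walk X n \<omega>))"
    by (intro Bochner_Integration.integral_cong) (auto simp: indicator_def)
  finally show ?thesis unfolding expectation_iexp_walk .
qed

lemma fourier_span_pos_cf: "fourier_span {0<..} (\<lambda>u. pos_cf u k)"
  unfolding pos_cf_def by (rule fourier_span_expectation) auto

lemma fourier_span_nonpos_cf: "fourier_span {..0} (\<lambda>u. nonpos_cf u k)"
  unfolding nonpos_cf_def by (rule fourier_span_expectation) auto

lemma fourier_span_record_cf:
  assumes "n > 0"
  shows "fourier_span {0<..} (\<lambda>u. record_cf u n)"
proof -
  have eq: "record_cf u n = (CLINT \<omega>|M. indicator {\<omega>\<in>space M. \<forall>j\<in>{..<n}. walk X j \<omega> < walk X n \<omega>} \<omega> *\<^sub>R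
       iexp (u * walk X n \<omega>))" for u
    unfolding record_cf_def record_term_def walk_def
    by (intro Bochner_Integration.integral_cong refl) (simp add: indicator_def)
  show ?thesis unfolding eq
  proof (rule fourier_span_expectation)
    fix \<omega> assume "\<omega> \<in> {\<omega>\<in>space M. \<forall>j\<in>{..<n}. walk X j \<omega> < walk X n \<omega>}"
    then have "walk X 0 \<omega> < walk X n \<omega>" using assms by blast
    then show "walk X n \<omega> \<in> {0<..}" by (simp add: walk_def)
  qed measurable
qed

lemma fourier_span_stay_nonpos_cf: "fourier_span {..0} (\<lambda>u. stay_nonpos_cf u n)"
proof -
  have eq: "stay_nonpos_cf u n = (CLINT \<omega>|M. indicator {\<omega>\<in>space M. \<forall>j\<in>{..n}. walk X j \<omega> \<le> 0} \<omega> *\<^sub>R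
       iexp (u * walk X n \<omega>))" for u
    unfolding stay_nonpos_cf_def stay_nonpos_term_def walk_def
    by (intro Bochner_Integration.integral_cong refl) (simp add: indicator_def)
  show ?thesis unfolding eq by (rule fourier_span_expectation) auto
qed

lemma record_cf_0: "record_cf u 0 = 1"
  by (simp add: record_cf_def record_term_def prob_space)

lemma stay_nonpos_cf_0: "stay_nonpos_cf u 0 = 1"
  by (simp add: stay_nonpos_cf_def stay_nonpos_term_def prob_space)

text \<open>
  For \<open>t = -u\<close> the maximum cancels from \<open>u M + t (M - S)\<close> and the characteristic function of \<open>S\<^sub>n\<close> remains.
\<close>

lemma record_stay_nonpos_convolution: "(\<Sum>k=0..n. record_cf u k * stay_nonpos_cf u (n - k)) = step_cf u ^ n"
proof -
  have "(\<Sum>k=0..n. record_cf u k * stay_nonpos_cf u (n - k)) = joint_cf M X n u (- u)"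
    by (simp add: joint_cf_decomposition)
  also have "\<dots> = (CLINT \<omega>|M. iexp (u * walk X n \<omega>))"
    unfolding joint_cf_def by (simp add: algebra_simps)
  finally show ?thesis unfolding expectation_iexp_walk .
qed

text \<open>
  The probabilistic factors and the two exponentials are factorizations of the same series, so
  uniqueness identifies them.
\<close>

lemma record_stay_nonpos_eq_exp_series:
  "record_cf u n = fps_nth (exp_series (pos_cf u)) n \<and> stay_nonpos_cf u n = fps_nth (exp_series (nonpos_cf u)) n"
  by (rule factorization_unique[where f=step_cf])
     (simp_all add: record_cf_0 stay_nonpos_cf_0 fourier_span_record_cf fourier_span_stay_nonpos_cf
       fourier_span_pos_cf fourier_span_nonpos_cf pos_cf_add_nonpos_cf record_stay_nonpos_convolution)

lemma norm_cf_le_1: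
  "norm (pos_cf u k) \<le> 1" "norm (nonpos_cf u k) \<le> 1" "norm (record_cf u k) \<le> 1" "norm (stay_nonpos_cf u k) \<le> 1"
  unfolding pos_cf_def nonpos_cf_def record_cf_def stay_nonpos_cf_def
  by (intro norm_expectation_le_1; simp add: indicator_def norm_record_term_le norm_stay_nonpos_term_le)+

text \<open>
  The decomposition at the maximum is a Cauchy product, and each of its factors is the
  exponential of a logarithmic series.
\<close>

theorem spitzer_identity:
  assumes "norm z < 1"
  shows "(\<lambda>n. joint_cf M X n s t * z ^ n) sums
    exp ((\<Sum>k. pos_cf s k / of_nat k * z ^ k) + (\<Sum>k. nonpos_cf (- t) k / of_nat k * z ^ k))"
proof -
  let ?a = "\<lambda>n. record_cf s n * z ^ n" and ?b = "\<lambda>n. stay_nonpos_cf (- t) n * z ^ n"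
  have a: "?a sums exp (\<Sum>k. pos_cf s k / of_nat k * z ^ k)"
    using exp_series_sums[of "pos_cf s"] norm_cf_le_1 assms by (simp flip: record_stay_nonpos_eq_exp_series)
  have b: "?b sums exp (\<Sum>k. nonpos_cf (- t) k / of_nat k * z ^ k)"
    using exp_series_sums[of "nonpos_cf (- t)"] norm_cf_le_1 assms by (simp flip: record_stay_nonpos_eq_exp_series)
  have geo: "summable (\<lambda>n. norm z ^ n)" using assms by (intro summable_geometric) simp
  have "summable (\<lambda>n. norm (?a n))" "summable (\<lambda>n. norm (?b n))"
    by (rule summable_comparison_test'[OF geo, of 0];
        simp add: norm_mult norm_power norm_cf_le_1 mult_left_le_one_le)+
  from Cauchy_product_sums[OF this]
  have "(\<lambda>n. \<Sum>k\<le>n. ?a k * ?b (n - k)) sums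
     (exp (\<Sum>k. pos_cf s k / of_nat k * z ^ k) * exp (\<Sum>k. nonpos_cf (- t) k / of_nat k * z ^ k))"
    using a b by (simp add: sums_iff)
  moreover have "(\<Sum>k\<le>n. ?a k * ?b (n - k)) = joint_cf M X n s t * z ^ n" for n
    unfolding joint_cf_decomposition sum_distrib_right atLeast0AtMost
  proof (intro sum.cong refl)
    fix k assume "k \<in> {..n}"
    then have "z ^ n = z ^ k * z ^ (n - k)" by (simp flip: power_add)
    then show "?a k * ?b (n - k) = record_cf s k * stay_nonpos_cf (- t) (n - k) * z ^ n" by simp
  qed
  ultimately show ?thesis by (simp add: exp_add)
qed

end

section \<open>The principal value of the logarithm\<close>

text \<open>
  For \<open>a k = w ^ k\<close> this is \<open>-ln(1 - z w)\<close>.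
\<close>

definition log_series :: "complex \<Rightarrow> (nat \<Rightarrow> complex) \<Rightarrow> complex" where
  "log_series z a = (\<Sum>k. a k / of_nat k * z ^ k)"

lemma norm_log_series_term_le:
  fixes a :: complex
  assumes "norm a \<le> C" 
  shows "norm (a / of_nat k * z ^ k) \<le> C * norm z ^ k"
proof (cases "k = 0")
  case True
  then show ?thesis using order_trans[OF norm_ge_zero assms] by simp
next
  case False
  have "norm a / real k \<le> norm a / 1" using False by (intro divide_left_mono) auto
  then have "norm (a / of_nat k) \<le> C" using assms by (simp add: norm_divide)
  then have "norm (a / of_nat k) * norm z ^ k \<le> C * norm z ^ k" by (intro mult_right_mono) auto
  then show ?thesis by (simp only: norm_mult norm_power)
qed

lemma summable_log_series:
  fixes a :: "nat \<Rightarrow> complex"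
  assumes "norm z < 1" "\<And>k. norm (a k) \<le> C"
  shows "summable (\<lambda>k. a k / of_nat k * z ^ k)"
proof (rule summable_comparison_test')
  show "summable (\<lambda>k. C * norm z ^ k)" using assms(1) by (intro summable_mult summable_geometric) simp
qed (rule norm_log_series_term_le[OF assms(2)])

lemma log_series_add:
  assumes "norm z < 1" "\<And>k. norm (a k) \<le> C" "\<And>k. norm (b k) \<le> D"
  shows "log_series z (\<lambda>k. a k + b k) = log_series z a + log_series z b"
  unfolding log_series_def suminf_add[OF summable_log_series[OF assms(1,2)] summable_log_series[OF assms(1,3)]]
  by (simp add: add_divide_distrib distrib_right)

lemma log_series_diff:
  assumes "norm z < 1" "\<And>k. norm (a k) \<le> C" "\<And>k. norm (b k) \<le> D"
  shows "log_series z (\<lambda>k. a k - b k) = log_series z a - log_series z b"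
  unfolding log_series_def suminf_diff[OF summable_log_series[OF assms(1,2)] summable_log_series[OF assms(1,3)]]
  by (simp add: diff_divide_distrib left_diff_distrib)

lemma log_series_power:
  assumes "norm z < 1" "norm w \<le> 1"
  shows "(\<lambda>k. w ^ k / of_nat k * z ^ k) sums (- ln (1 - z * w))" "log_series z (\<lambda>k. w ^ k) = - ln (1 - z * w)"
proof -
  have "norm (z * w) \<le> norm z * 1" unfolding norm_mult using assms(2) by (intro mult_left_mono) auto
  then have "norm (- (z * w)) < 1" using assms(1) by simp
  from sums_minus[OF Ln_series'[OF this]]
  show "(\<lambda>k. w ^ k / of_nat k * z ^ k) sums (- ln (1 - z * w))"
    by (simp add: power_mult_distrib mult_ac)
  then show "log_series z (\<lambda>k. w ^ k) = - ln (1 - z * w)" by (simp add: log_series_def sums_iff)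
qed

lemma Re_one_minus_pos:
  assumes "norm z < 1" "norm w \<le> 1"
  shows "0 < Re (1 - z * w)"
proof -
  have "norm (z * w) \<le> norm z * 1" unfolding norm_mult using assms(2) by (intro mult_left_mono) auto
  then show ?thesis using complex_Re_le_cmod[of "z * w"] assms(1) by simp
qed

text \<open>
  In the right half-plane arguments lie strictly between \<open>-\<pi>/2\<close> and \<open>\<pi>/2\<close>, so differences and sums of two of
  them stay in the range of the principal branch.
\<close>

lemma ln_divide_Re_pos:
  assumes "0 < Re a" "0 < Re b"
  shows "ln (a / b) = ln a - ln (b :: complex)"
proof -
  have nz: "a \<noteq> 0" "b \<noteq> 0" using assms by auto
  have "exp (ln a - ln b) = a / b" using nz by (simp add: exp_diff)
  moreover have "ln (exp (ln a - ln b)) = ln a - ln b"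
    using Re_Ln_pos_lt_imp[OF assms(1)] Re_Ln_pos_lt_imp[OF assms(2)] by (intro Ln_exp) auto
  ultimately show ?thesis by simp
qed

lemma csqrt_mult_Re_pos:
  assumes "0 < Re a" "0 < Re b"
  shows "csqrt (a * b) = exp ((ln a + ln b) / 2)"
proof -
  have nz: "a \<noteq> 0" "b \<noteq> 0" using assms by auto
  have "exp (ln a + ln b) = a * b" using nz by (simp add: exp_add)
  moreover have "ln (exp (ln a + ln b)) = ln a + ln b"
    using Re_Ln_pos_lt_imp[OF assms(1)] Re_Ln_pos_lt_imp[OF assms(2)] by (intro Ln_exp) auto
  ultimately have "ln (a * b) = ln a + ln b" by simp
  then show ?thesis using nz csqrt_exp_Ln[of "a * b"] by simp
qed

text \<open>
  Two interchanges are needed. On a fixed truncated domain the series is dominated by a multiple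
  of the geometric one, so it may be integrated term by term (\<open>swap\<close>). In the limit the bound on the
  truncated transforms that is uniform in the cut-offs makes Tannery's theorem applicable.
\<close>

lemma tendsto_trunc_hilbert_log_series:
  fixes D :: "nat \<Rightarrow> real measure"
  assumes D: "\<And>k. real_distribution (D k)" and z: "norm z < 1"
  shows "((\<lambda>(\<epsilon>, A). trunc_hilbert (\<lambda>u. log_series z (\<lambda>k. char (D k) (s + u))) \<epsilon> A) \<longlongrightarrow>
     \<i> * pi * log_series z (\<lambda>k. CLINT x|D k. iexp (s * x) * of_real (sgn x))) pv_filter"
proof -
  let ?h = "\<lambda>k u. char (D k) (s + u)"
  let ?a = "\<lambda>k (\<epsilon>, A). trunc_hilbert (?h k) \<epsilon> A / of_nat k * z ^ k"
  let ?b = "\<lambda>k. \<i> * pi * (CLINT x|D k. iexp (s * x) * of_real (sgn x)) / of_nat k * z ^ k"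
  obtain B where B: "\<And>T. \<bar>Si T\<bar> \<le> B" using bounded_Si by blast
  have h1: "norm (char (D k) v) \<le> 1" for k v
    by (rule real_distribution.cmod_char_le_1[OF D])
  have cont: "isCont (char (D k)) v" for k v
    by (rule real_distribution.isCont_char[OF D])
  have T_bound: "norm (trunc_hilbert (?h k) \<epsilon> A) \<le> 4 * B" if "0 < \<epsilon>" "\<epsilon> \<le> A" for k \<epsilon> A
  proof -
    interpret real_distribution "D k" by (rule D)
    show ?thesis using norm_trunc_hilbert_char_le[OF B that, of s] prob_space by simp
  qed
  have swap: "trunc_hilbert (\<lambda>u. log_series z (\<lambda>k. ?h k u)) \<epsilon> A = (\<Sum>k. ?a k (\<epsilon>, A))"
    if \<epsilon>: "0 < \<epsilon>" "\<epsilon> \<le> A" for \<epsilon> A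
  proof -
    let ?g = "\<lambda>k u. indicator {\<epsilon>..A} u *\<^sub>R ((?h k u - ?h k (- u)) / of_real u / of_nat k * z ^ k)"
    have int: "integrable lborel (?g k)" for k
    proof -
      have "set_integrable lborel {\<epsilon>..A} (\<lambda>u. (?h k u - ?h k (- u)) / of_real u / of_nat k * z ^ k)"
        by (rule borel_integrable_atLeastAtMost', cases "k = 0")
           (use \<epsilon> in \<open>auto intro!: continuous_intros continuous_at_imp_continuous_on
              isCont_o2[OF _ cont]\<close>)
      then show ?thesis by (simp add: set_integrable_def)
    qed
    have g_bound: "norm (?g k u) \<le> indicator {\<epsilon>..A} u *\<^sub>R (2 / \<epsilon> * norm z ^ k)" for k u
    proof (cases "u \<in> {\<epsilon>..A}")
      case True
      have "norm (?h k u - ?h k (- u)) \<le> 2"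
        using norm_triangle_ineq4[of "?h k u" "?h k (- u)"] h1[of k "s + u"] h1[of k "s + - u"] by linarith
      then have "norm ((?h k u - ?h k (- u)) / of_real u) \<le> 2 / \<epsilon>"
        unfolding norm_divide using True \<epsilon> by (intro frac_le) auto
      moreover have "indicator {\<epsilon>..A} u = (1::real)" using True by simp
      ultimately show ?thesis by (simp only: scaleR_one norm_log_series_term_le)
    qed simp
    have int': "integrable lborel (\<lambda>u. indicator {\<epsilon>..A} u *\<^sub>R (2 / \<epsilon> * norm z ^ k))" for k
      using \<epsilon> by (intro integrable_scaleR_left integrable_real_indicator) auto
    have geo: "summable (\<lambda>k. C * norm z ^ k)" for C :: real
      using z by (intro summable_mult summable_geometric) simp
    have "(\<lambda>k. integral\<^sup>L lborel (?g k)) sums (LINT u|lborel. (\<Sum>k. ?g k u))"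
    proof (rule sums_integral[OF int])
      show "AE u in lborel. summable (\<lambda>k. norm (?g k u))"
      proof (rule AE_I2)
        fix u
        show "summable (\<lambda>k. norm (?g k u))"
          by (rule summable_comparison_test'[OF geo[of "indicator {\<epsilon>..A} u * (2 / \<epsilon>)"], of 0])
             (use g_bound[where u=u] in \<open>simp add: mult.assoc\<close>)
      qed
      show "summable (\<lambda>k. LINT u|lborel. norm (?g k u))"
      proof (rule summable_comparison_test'[OF geo[of "(A - \<epsilon>) * (2 / \<epsilon>)"], of 0])
        fix k
        have "(LINT u|lborel. norm (?g k u)) \<le> (LINT u|lborel. indicator {\<epsilon>..A} u *\<^sub>R (2 / \<epsilon> * norm z ^ k))"
          by (intro integral_mono integrable_norm int int' g_bound)
        also have "\<dots> = (A - \<epsilon>) * (2 / \<epsilon>) * norm z ^ k" using \<epsilon> by simp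
        finally show "norm (LINT u|lborel. norm (?g k u)) \<le> (A - \<epsilon>) * (2 / \<epsilon>) * norm z ^ k"
          by simp
      qed
    qed
    moreover have "integral\<^sup>L lborel (?g k) = ?a k (\<epsilon>, A)" for k
    proof -
      have "?g k = (\<lambda>u. (indicator {\<epsilon>..A} u *\<^sub>R ((?h k u - ?h k (- u)) / of_real u)) * (z ^ k / of_nat k))"
        by (auto simp: fun_eq_iff indicator_def)
      then show ?thesis unfolding trunc_hilbert_def set_lebesgue_integral_def
        by (simp only: integral_mult_left_zero case_prod_conv) simp
    qed
    moreover have "(\<Sum>k. ?g k u) = indicator {\<epsilon>..A} u *\<^sub>R
        ((log_series z (\<lambda>k. ?h k u) - log_series z (\<lambda>k. ?h k (- u))) / of_real u)" for u
    proof -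
      have "(\<lambda>k. (?h k u - ?h k (- u)) / of_nat k * z ^ k) sums log_series z (\<lambda>k. ?h k u - ?h k (- u))"
        unfolding log_series_def
        using summable_diff[OF summable_log_series[OF z h1] summable_log_series[OF z h1], of "\<lambda>k. k" "\<lambda>_. s + u" "\<lambda>k. k" "\<lambda>_. s + - u"]
        by (intro summable_sums) (simp add: diff_divide_distrib left_diff_distrib)
      then have "(\<lambda>k. ?g k u) sums (indicator {\<epsilon>..A} u *\<^sub>R (log_series z (\<lambda>k. ?h k u - ?h k (- u)) / of_real u))"
        by (intro sums_scaleR_right) (auto dest: sums_divide[where c="of_real u"] simp: field_simps)
      then show ?thesis using log_series_diff[OF z h1 h1] by (simp add: sums_iff)
    qed
    ultimately show ?thesis
      unfolding trunc_hilbert_def set_lebesgue_integral_def by (simp only: sums_iff)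
  qed
  have "((\<lambda>p. \<Sum>k. ?a k p) \<longlongrightarrow> (\<Sum>k. ?b k)) pv_filter"
  proof -
    have lim: "((\<lambda>p. ?a k p) \<longlongrightarrow> ?b k) pv_filter" for k
    proof -
      interpret real_distribution "D k" by (rule D)
      have "((\<lambda>p. (\<lambda>(\<epsilon>, A). trunc_hilbert (?h k) \<epsilon> A) p * (z ^ k / of_nat k)) \<longlongrightarrow>
          \<i> * pi * (CLINT x|D k. iexp (s * x) * of_real (sgn x)) * (z ^ k / of_nat k)) pv_filter"
        by (intro tendsto_mult_right tendsto_trunc_hilbert_char)
      then show ?thesis by (simp add: split_def)
    qed
    have bound: "eventually (\<lambda>(k, p). norm (?a k p) \<le> 4 * B * norm z ^ k) (at_top \<times>\<^sub>F pv_filter)"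
    proof (rule eventually_mono[OF eventually_prodI[OF always_eventually eventually_pv_filter]])
      show "\<forall>k::nat. True" by simp
      fix q :: "nat \<times> real \<times> real"
      assume q: "True \<and> (case snd q of (\<epsilon>, A) \<Rightarrow> 0 < \<epsilon> \<and> \<epsilon> < A)"
      obtain k \<epsilon> A where [simp]: "q = (k, \<epsilon>, A)" by (cases q) auto
      show "case q of (k, p) \<Rightarrow> norm (?a k p) \<le> 4 * B * norm z ^ k"
        using q norm_log_series_term_le[OF T_bound, of \<epsilon> A] by simp
    qed
    have sum: "summable (\<lambda>k. 4 * B * norm z ^ k)"
      using z by (intro summable_mult summable_geometric) simp
    show ?thesis
      using tannerys_theorem[where a="?a" and b="?b", OF lim bound sum pv_filter_nonbot] by (elim conjE)
  qed
  moreover have "(\<Sum>k. ?b k) = \<i> * pi * log_series z (\<lambda>k. CLINT x|D k. iexp (s * x) * of_real (sgn x))"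
  proof -
    have "norm (CLINT x|D k. iexp (s * x) * of_real (sgn x)) \<le> 1" for k
    proof -
      interpret real_distribution "D k" by (rule D)
      have "norm (CLINT x|D k. iexp (s * x) * of_real (sgn x)) \<le>
          (LINT x|D k. norm (iexp (s * x) * of_real (sgn x)))" by (rule integral_norm_bound)
      also have "\<dots> \<le> (LINT x|D k. 1)"
        by (rule Bochner_Integration.integral_mono') (auto simp: norm_mult sgn_if)
      finally show ?thesis using prob_space by simp
    qed
    from suminf_mult[OF summable_log_series[OF z this], of "\<i> * pi"] show ?thesis
      by (simp add: log_series_def mult.assoc)
  qed
  moreover have "eventually (\<lambda>p. (\<Sum>k. ?a k p) =
      (\<lambda>(\<epsilon>, A). trunc_hilbert (\<lambda>u. log_series z (\<lambda>k. ?h k u)) \<epsilon> A) p) pv_filter"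
    by (rule eventually_mono[OF eventually_pv_filter]) (use swap in auto)
  ultimately show ?thesis by (simp only: Lim_transform_eventually)
qed

section \<open>The integral formula\<close>

context iid_steps
begin

lemma real_distribution_walk: "real_distribution (distr M borel (walk X k))"
  by (intro real_distribution_distr) measurable

lemma norm_step_cf_le_1: "norm (step_cf u) \<le> 1"
  unfolding step_cf_def by (intro real_distribution.cmod_char_le_1 real_distribution_distr) measurable

lemma step_cf_0: "step_cf 0 = 1"
  unfolding step_cf_def by (intro real_distribution.char_zero real_distribution_distr) measurable

lemma continuous_on_step_cf [continuous_intros]:
  assumes "continuous_on S g"
  shows "continuous_on S (\<lambda>u. step_cf (g u))"
proof -
  have "isCont step_cf u" for u
    unfolding step_cf_def by (intro real_distribution.isCont_char real_distribution_distr) measurable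
  then have "continuous_on UNIV step_cf" by (intro continuous_at_imp_continuous_on) auto
  then show ?thesis by (rule continuous_on_compose2[OF _ assms]) auto
qed

text \<open>
  Since \<open>sgn 0 = 0\<close> while \<open>nonpos_cf\<close> counts the event \<open>S\<^sub>k = 0\<close>, that probability has to be added back.
\<close>

lemma expectation_sgn_walk:
  "(CLINT x|distr M borel (walk X k). iexp (s * x) * of_real (sgn x)) =
     pos_cf s k - nonpos_cf s k + of_real (prob {\<omega>\<in>space M. walk X k \<omega> = 0})"
proof -
  let ?Z = "{\<omega>\<in>space M. walk X k \<omega> = 0}"
  let ?p = "\<lambda>\<omega>. indicator {\<omega>\<in>space M. walk X k \<omega> > 0} \<omega> *\<^sub>R iexp (s * walk X k \<omega>)"
  let ?n = "\<lambda>\<omega>. indicator {\<omega>\<in>space M. walk X k \<omega> \<le> 0} \<omega> *\<^sub>R iexp (s * walk X k \<omega>)"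
  have int: "integrable M ?p" "integrable M ?n" "integrable M (\<lambda>\<omega>. complex_of_real (indicator ?Z \<omega>))"
    by (rule integrable_bounded; (measurable | simp add: indicator_def))+
  have "of_real (prob ?Z) = (CLINT \<omega>|M. complex_of_real (indicator ?Z \<omega>))"
    by simp
  then have "pos_cf s k - nonpos_cf s k + of_real (prob ?Z) =
      (CLINT \<omega>|M. ?p \<omega> - ?n \<omega> + complex_of_real (indicator ?Z \<omega>))"
    unfolding pos_cf_def nonpos_cf_def using int by simp
  also have "\<dots> = (CLINT \<omega>|M. iexp (s * walk X k \<omega>) * of_real (sgn (walk X k \<omega>)))"
    by (intro Bochner_Integration.integral_cong) (auto simp: indicator_def sgn_if)
  also have "\<dots> = (CLINT x|distr M borel (walk X k). iexp (s * x) * of_real (sgn x))"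
    by (rule integral_distr[symmetric]) measurable
  finally show ?thesis ..
qed

lemma tendsto_trunc_hilbert_log:
  assumes z: "norm z < 1"
  shows "((\<lambda>(\<epsilon>, A). trunc_hilbert (\<lambda>u. - ln (1 - z * step_cf (s + u))) \<epsilon> A) \<longlongrightarrow>
    \<i> * pi * (log_series z (pos_cf s) - log_series z (nonpos_cf s) +
      log_series z (\<lambda>k. of_real (prob {\<omega>\<in>space M. walk X k \<omega> = 0})))) pv_filter"
proof -
  have *: "log_series z (\<lambda>k. char (distr M borel (walk X k)) (s + u)) = - ln (1 - z * step_cf (s + u))" for u
    unfolding char_walk by (rule log_series_power[OF z norm_step_cf_le_1])
  have bd: "norm (pos_cf s k - nonpos_cf s k) \<le> 2" for k
    using norm_triangle_ineq4[of "pos_cf s k" "nonpos_cf s k"] norm_cf_le_1(1,2)[of s k] by linarith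
  have bp: "norm (complex_of_real (prob {\<omega>\<in>space M. walk X k \<omega> = 0})) \<le> 1" for k
    by (simp add: measure_nonneg)
  show ?thesis
    using tendsto_trunc_hilbert_log_series[where D="\<lambda>k. distr M borel (walk X k)",
        OF real_distribution_walk z, of s]
    unfolding * expectation_sgn_walk log_series_add[OF z bd bp]
      log_series_diff[OF z norm_cf_le_1(1) norm_cf_le_1(2)] by simp
qed

lemma neg_ln_eq_log_series:
  assumes "norm z < 1"
  shows "- ln (1 - z * step_cf u) = log_series z (pos_cf u) + log_series z (nonpos_cf u)"
  unfolding log_series_power(2)[OF assms norm_step_cf_le_1, symmetric] pos_cf_add_nonpos_cf[symmetric]
  using log_series_add[OF assms norm_cf_le_1(1,2)] by simp

text \<open>
  Write \<open>\<lambda>(v) = -ln(1 - z f(v))\<close> with \<open>f\<close> the characteristic function of a step. The integrand is even,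
  so both half-lines contribute equally, and on the positive one it
  is the integrand of \<open>trunc_hilbert\<close> for \<open>u \<mapsto> \<lambda>(s + u) - \<lambda>(-t + u)\<close>. With \<open>P\<close> and \<open>N\<close> for the logarithmic series of the
  positive and nonpositive parts, the principal value is
  \<open>2\<pi>i (P(s) - N(s) - P(-t) + N(-t))\<close> and the square root is \<open>exp(-(P(s) + N(s) + P(-t) + N(-t))/2)\<close>. Dividing the
  former by \<open>4\<pi>i\<close>, exponentiating, and dividing by the square root leaves \<open>exp(P(s) + N(-t))\<close>.
\<close>

theorem pollaczek_spitzer_pv:
  assumes z: "norm z < 1"
  shows "\<exists>I. has_pv_integral
            (\<lambda>u. (ln ((1 - z * step_cf (s - u)) / (1 - z * step_cf (s + u)))
                  + ln ((1 - z * step_cf (- t + u)) / (1 - z * step_cf (- t - u)))) / of_real u) I \<and>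
          (\<lambda>n. joint_cf M X n s t * z ^ n) sums
            (1 / csqrt ((1 - z * step_cf s) * (1 - z * step_cf (- t))) * exp (1 / (4 * of_real pi * \<i>) * I))"
proof -
  let ?g = "\<lambda>u. (ln ((1 - z * step_cf (s - u)) / (1 - z * step_cf (s + u)))
                  + ln ((1 - z * step_cf (- t + u)) / (1 - z * step_cf (- t - u)))) / complex_of_real u"
  let ?P = "\<lambda>u. log_series z (pos_cf u)" and ?N = "\<lambda>u. log_series z (nonpos_cf u)"
  let ?Z = "log_series z (\<lambda>k. of_real (prob {\<omega>\<in>space M. walk X k \<omega> = 0}))"
  define lam where "lam v = - ln (1 - z * step_cf v)" for v
  define I where "I = 2 * \<i> * pi * ((?P s - ?N s) - (?P (- t) - ?N (- t)))"
  have Re_pos: "0 < Re (1 - z * step_cf v)" for v by (rule Re_one_minus_pos[OF z norm_step_cf_le_1])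
  have g: "?g u = (lam (s + u) - lam (s - u) - (lam (- t + u) - lam (- t - u))) / of_real u" for u
    unfolding ln_divide_Re_pos[OF Re_pos Re_pos] lam_def by simp
  have cont_lam: "continuous_on S (\<lambda>u. lam (h u))" if "continuous_on S h" for S and h :: "real \<Rightarrow> real"
    unfolding lam_def using that
  proof (intro continuous_intros)
    show "1 - z * step_cf (h u) \<notin> \<real>\<^sub>\<le>\<^sub>0" for u
      using Re_pos[of "h u"] by (auto simp: complex_nonpos_Reals_iff)
  qed
  have int: "set_integrable lborel {a..b} ?g" if "0 \<notin> {a..b}" for a b
    unfolding g using that
    by (intro borel_integrable_atLeastAtMost' continuous_intros cont_lam) auto
  have eq: "(LINT u:{\<epsilon>..A}|lborel. ?g u) + (LINT u:{-A..-\<epsilon>}|lborel. ?g u) =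
      2 * (trunc_hilbert (\<lambda>u. lam (s + u)) \<epsilon> A + trunc_hilbert (\<lambda>u. (-1) * lam (- t + u)) \<epsilon> A)"
    if "0 < \<epsilon>" for \<epsilon> A
  proof -
    have even: "?g (- u) = ?g u" for u
      unfolding g by (simp add: minus_divide_right[symmetric] minus_divide_left)
    have "(LINT u:{-A..-\<epsilon>}|lborel. ?g u) = (LINT u:{u. - u \<in> {-A..-\<epsilon>}}|lborel. ?g (- u))"
      by (rule set_integral_reflect)
    also have "{u. - u \<in> {-A..-\<epsilon>}} = {\<epsilon>..A}" by auto
    finally have "(LINT u:{-A..-\<epsilon>}|lborel. ?g u) = (LINT u:{\<epsilon>..A}|lborel. ?g u)"
      unfolding even .
    moreover have regroup: "x - y - (a - b) = x + (-1) * a - (y + (-1) * b)" for x y a b :: complex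
      by simp
    have "(LINT u:{\<epsilon>..A}|lborel. ?g u) =
        trunc_hilbert (\<lambda>u. lam (s + u) + (-1) * lam (- t + u)) \<epsilon> A"
      unfolding trunc_hilbert_def g regroup by simp
    moreover have "\<dots> = trunc_hilbert (\<lambda>u. lam (s + u)) \<epsilon> A + trunc_hilbert (\<lambda>u. (-1) * lam (- t + u)) \<epsilon> A"
      by (intro trunc_hilbert_add that continuous_intros cont_lam)
    ultimately show ?thesis by simp
  qed
  have lim: "((\<lambda>(\<epsilon>, A). trunc_hilbert (\<lambda>u. lam (v + u)) \<epsilon> A) \<longlongrightarrow> \<i> * pi * (?P v - ?N v + ?Z)) pv_filter" for v
    unfolding lam_def by (rule tendsto_trunc_hilbert_log[OF z])
  have "((\<lambda>p. 2 * ((\<lambda>(\<epsilon>, A). trunc_hilbert (\<lambda>u. lam (s + u)) \<epsilon> A) p +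
       (\<lambda>(\<epsilon>, A). trunc_hilbert (\<lambda>u. (-1) * lam (- t + u)) \<epsilon> A) p)) \<longlongrightarrow>
      2 * (\<i> * pi * (?P s - ?N s + ?Z) + (-1) * (\<i> * pi * (?P (- t) - ?N (- t) + ?Z)))) pv_filter"
    by (rule tendsto_mult_left[OF tendsto_add[OF lim tendsto_trunc_hilbert_cmult[OF lim]]])
  also have "2 * (\<i> * pi * (?P s - ?N s + ?Z) + (-1) * (\<i> * pi * (?P (- t) - ?N (- t) + ?Z))) = I"
    by (simp add: I_def algebra_simps)
  finally have "((\<lambda>(\<epsilon>, A). (LINT u:{\<epsilon>..A}|lborel. ?g u) + (LINT u:{-A..-\<epsilon>}|lborel. ?g u)) \<longlongrightarrow> I) pv_filter"
    by (rule Lim_transform_eventually)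
       (rule eventually_mono[OF eventually_pv_filter], use eq in \<open>auto simp: split_def\<close>)
  with int have pv: "has_pv_integral ?g I" unfolding has_pv_integral_def by auto
  have "csqrt ((1 - z * step_cf s) * (1 - z * step_cf (- t))) = exp (- ((lam s + lam (- t)) / 2))"
    unfolding csqrt_mult_Re_pos[OF Re_pos Re_pos] lam_def
    by (rule arg_cong[where f=exp]) (simp add: field_simps)
  then have "1 / csqrt ((1 - z * step_cf s) * (1 - z * step_cf (- t))) = exp ((lam s + lam (- t)) / 2)"
    by (simp only: exp_minus inverse_eq_divide) simp
  moreover have "(lam s + lam (- t)) / 2 + 1 / (4 * of_real pi * \<i>) * I = ?P s + ?N (- t)"
    unfolding lam_def neg_ln_eq_log_series[OF z] I_def by (simp add: field_simps)
  ultimately have "1 / csqrt ((1 - z * step_cf s) * (1 - z * step_cf (- t))) * exp (1 / (4 * of_real pi * \<i>) * I) =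
      exp (?P s + ?N (- t))"
    by (simp flip: exp_add)
  with spitzer_identity[OF z, of s t] pv show ?thesis
    unfolding log_series_def by (intro exI[of _ I] conjI) simp_all
qed

end

(* The family X comprises the generic copy X 0 together with the steps X 1, X 2, ... of the walk. *)
theorem corollary6:
  fixes M :: "'a measure" and X :: "nat \<Rightarrow> 'a \<Rightarrow> real" and f :: "real \<Rightarrow> complex"
    and s t :: real and z :: complex
  assumes "prob_space M"
    and "prob_space.indep_vars M (\<lambda>_. borel) X UNIV"
    and "\<And>j. distr M borel (X j) = distr M borel (X 0)"
    and "f = char (distr M borel (X 0))"
    and "norm z < 1"
  shows "(\<exists>I. has_pv_integral
            (\<lambda>u. (ln ((1 - z * f (s - u)) / (1 - z * f (s + u)))
                  + ln ((1 - z * f (- t + u)) / (1 - z * f (- t - u)))) / of_real u) I \<and>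
          (\<lambda>n. joint_cf M X n s t * z ^ n) sums
            (1 / csqrt ((1 - z * f s) * (1 - z * f (- t))) * exp (1 / (4 * of_real pi * \<i>) * I)))
       \<and> (\<exists>I. has_pv_integral
            (\<lambda>u. (ln ((1 - z * f (s - u)) / (1 - z * f (s + u)))
                  + ln ((1 - z * f u) / (1 - z * f (- u)))) / of_real u) I \<and>
          (\<lambda>n. (LINT \<omega>|M. exp (\<i> * of_real (s * walk_max X n \<omega>))) * z ^ n) sums
            (1 / csqrt ((1 - z * f s) * (1 - z)) * exp (1 / (4 * of_real pi * \<i>) * I)))"
proof -
  interpret iid_steps M X
    by (intro iid_steps.intro iid_steps_axioms.intro assms(1-3))
  have f_eq: "f = iid_steps.step_cf M X"
    using assms(4) by (simp add: step_cf_def)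
  show ?thesis
    unfolding f_eq
    using pollaczek_spitzer_pv[OF assms(5), of s t] pollaczek_spitzer_pv[OF assms(5), of s 0]
    by (simp add: step_cf_0 joint_cf_def)
qed

end
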